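(* Let $f\colon\subseteq[0,1]\to\mathbb{R}$ be computable on $I_{\mathbb{Q}}=[0,1]\cap\mathbb{Q}$, i.e., $f(q)$ is defined for each $q\in I_{\mathbb{Q}}$ and is a computable real uniformly in $q$. Then $f$ satisfies the Denjoy alternative at every weakly $2$-random real $z$.
   Context: For a partial function $f\colon\subseteq[0,1]\to\mathbb{R}$ with dense domain, let $S_f(a,b)=\frac{f(a)-f(b)}{a-b}$. The lower and upper pseudo-derivatives at $x$ are $\underset{\sim}{D}f(x)=\liminf_{h\to 0^+}\{S_f(a,b)\mid a,b\in\mathrm{dom}(f),\ a\le x\le b,\ 0<b-a\le h\}$ and $\widetilde Df(x)=\limsup_{h\to 0^+}\{S_f(a,b)\mid a,b\in\mathrm{dom}(f),\ a\le x\le b,\ 0<b-a\le h\}$ (here $a,b$ may be taken to range over rationals). $f$ satisfies the Denjoy alternative at $z$ if either $\widetilde Df(z)=\underset{\sim}{D}f(z)$, or $\widetilde Df(z)=+\infty$ and $\underset{\sim}{D}f(z)=-\infty$. A real is weakly $2$-random if it lies in no null $\Pi^0_2$ class. *)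

theory Defs
  imports "HOL-Analysis.Analysis" "HOL-Library.Countable"
begin

text \<open>
  Total recursive functions in Kleene's sense: minimization is applied only where it is total.
  \<open>recursive n g\<close> constrains \<open>g\<close> only on argument lists of length \<open>n\<close>; its values on other
  lists are irrelevant.
\<close>

inductive recursive :: "nat \<Rightarrow> (nat list \<Rightarrow> nat) \<Rightarrow> bool" where
  zero: "recursive n (\<lambda>xs. 0)"
| succ: "recursive 1 (\<lambda>xs. Suc (xs ! 0))"
| proj: "i < n \<Longrightarrow> recursive n (\<lambda>xs. xs ! i)"
| comp: "recursive (length hs) g \<Longrightarrow> (\<And>h. h \<in> set hs \<Longrightarrow> recursive n h) \<Longrightarrow>
    recursive n (\<lambda>xs. g (map (\<lambda>h. h xs) hs))"
| prim_rec: "recursive n g \<Longrightarrow> recursive (Suc (Suc n)) h \<Longrightarrow>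
    recursive (Suc n) (\<lambda>xs. rec_nat (g (tl xs)) (\<lambda>k r. h (k # r # tl xs)) (hd xs))"
| minim: "recursive (Suc n) g \<Longrightarrow> (\<And>xs. length xs = n \<Longrightarrow> \<exists>y. g (y # xs) = 0) \<Longrightarrow>
    recursive n (\<lambda>xs. LEAST y. g (y # xs) = 0)"

definition computable2 :: "(nat \<Rightarrow> nat \<Rightarrow> nat) \<Rightarrow> bool" where
  "computable2 F \<longleftrightarrow> (\<exists>g. recursive 2 g \<and> (\<forall>x y. F x y = g [x, y]))"

text \<open>
  The numbering of the rationals is the effective library enumeration, which decodes \<open>i\<close> to a pair
  of integers and returns their quotient (\<open>0\<close> if the second one is \<open>0\<close>). It is surjective, not
  injective.
\<close>

definition nth_rat :: "nat \<Rightarrow> real" where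
  "nth_rat i = real_of_rat (nat_to_rat_surj i)"

definition I_Q :: "real set" where
  "I_Q = {0..1} \<inter> \<rat>"

text \<open>
  \<open>g i n\<close> is an index of a rational approximation of \<open>f q\<close>, for \<open>q = nth_rat i\<close>, with error at
  most \<open>1 / 2 ^ n\<close>. Totality of \<open>g\<close> is no restriction, since \<open>nth_rat i \<in> I_Q\<close> is decidable.
\<close>

definition computable_on_I_Q :: "(real \<rightharpoonup> real) \<Rightarrow> bool" where
  "computable_on_I_Q f \<longleftrightarrow> I_Q \<subseteq> dom f \<and>
     (\<exists>g. computable2 g \<and>
       (\<forall>i n. nth_rat i \<in> I_Q \<longrightarrow> \<bar>the (f (nth_rat i)) - nth_rat (g i n)\<bar> \<le> 1 / 2 ^ n))"

text \<open>
  Uniformly \<open>\<Sigma>\<^sup>0\<^sub>1\<close> sequences of classes: each \<open>U n\<close> is the union of a sequence of open rational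
  intervals that is computable uniformly in \<open>n\<close>. Intervals may be empty, so finite and empty
  unions are included.
\<close>

definition uniformly_Sigma01 :: "(nat \<Rightarrow> real set) \<Rightarrow> bool" where
  "uniformly_Sigma01 U \<longleftrightarrow> (\<exists>a b. computable2 a \<and> computable2 b \<and>
     (\<forall>n. U n = (\<Union>m. {nth_rat (a n m)<..<nth_rat (b n m)})))"

definition Pi02_class :: "real set \<Rightarrow> bool" where
  "Pi02_class P \<longleftrightarrow> (\<exists>U. uniformly_Sigma01 U \<and> P = (\<Inter>n. U n))"

definition weakly_2_random :: "real \<Rightarrow> bool" where
  "weakly_2_random z \<longleftrightarrow> (\<forall>P. Pi02_class P \<and> P \<in> null_sets lborel \<longrightarrow> z \<notin> P)"

definition slope :: "(real \<rightharpoonup> real) \<Rightarrow> real \<Rightarrow> real \<Rightarrow> real" where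
  "slope f a b = (the (f a) - the (f b)) / (a - b)"

text \<open>
  The endpoints range over the rationals in the domain. For a function that is only controlled on
  the rationals this is essential: if \<open>f\<close> vanishes except that \<open>f (z + 1 / 2 ^ n) = 1 / 2 ^ n\<close>
  for an irrational \<open>z\<close> and all large \<open>n\<close>, then arbitrary endpoints in the domain would yield the
  lower and upper values \<open>0\<close> and \<open>1\<close> at \<open>z\<close>.
\<close>

definition slopes_near :: "(real \<rightharpoonup> real) \<Rightarrow> real \<Rightarrow> real \<Rightarrow> real set" where
  "slopes_near f x h =
     {slope f a b | a b. a \<in> dom f \<inter> \<rat> \<and> b \<in> dom f \<inter> \<rat> \<and>
        a \<le> x \<and> x \<le> b \<and> 0 < b - a \<and> b - a \<le> h}"

definition lower_pseudo_deriv :: "(real \<rightharpoonup> real) \<Rightarrow> real \<Rightarrow> ereal" where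
  "lower_pseudo_deriv f x = Liminf (at_right 0) (\<lambda>h. INF s\<in>slopes_near f x h. ereal s)"

definition upper_pseudo_deriv :: "(real \<rightharpoonup> real) \<Rightarrow> real \<Rightarrow> ereal" where
  "upper_pseudo_deriv f x = Limsup (at_right 0) (\<lambda>h. SUP s\<in>slopes_near f x h. ereal s)"

definition Denjoy_alternative :: "(real \<rightharpoonup> real) \<Rightarrow> real \<Rightarrow> bool" where
  "Denjoy_alternative f z \<longleftrightarrow>
     upper_pseudo_deriv f z = lower_pseudo_deriv f z \<or>
     (upper_pseudo_deriv f z = \<infinity> \<and> lower_pseudo_deriv f z = -\<infinity>)"

end

theory Submission
  imports Defs
begin

text \<open>
  If the alternative fails at \<open>z\<close>, then after replacing \<open>f\<close> by \<open>-f\<close> if necessary the lower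
  pseudo-derivative at \<open>z\<close> is finite and smaller than the upper one. So there are rationals
  \<open>t < q < r\<close> with \<open>2 (q - t) < r - t\<close> such that all slopes through \<open>z\<close> at small scales are at least
  \<open>t\<close>, while slopes below \<open>q\<close> and slopes above \<open>r\<close> occur at arbitrarily small scales. The
  last two conditions are \<open>\<Pi>\<^sup>0\<^sub>2\<close> and, for a fixed scale, the first one is \<open>\<Pi>\<^sup>0\<^sub>1\<close>; together they
  define a \<open>\<Pi>\<^sup>0\<^sub>2\<close> class containing \<open>z\<close>, and it remains to see that it is null.

  Subtracting \<open>t x\<close>, we may take \<open>t = 0\<close>, so that \<open>f a \<le> f b\<close> for nearby \<open>a < b\<close> separated by a point of
  the class \<open>P\<close>. Take a short interval \<open>I\<close> around a point of \<open>P\<close> with slope less than \<open>q\<close>, and cover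
  \<open>P \<inter> I\<close> up to a null set by disjoint intervals with slope greater than \<open>r\<close> meeting \<open>P\<close>. By the
  monotonicity their increments sum up to at most twice the increment over \<open>I\<close>, hence
  \<open>\<bar>P \<inter> I\<bar> \<le> (2 q / r) \<bar>I\<bar>\<close>. A second use of Vitali's theorem shows that \<open>P\<close> is null. Leaving a factor 2
  between the slopes avoids Lebesgue's density theorem; it is harmless because \<open>t\<close> and \<open>q\<close> can be
  chosen arbitrarily close to the lower pseudo-derivative.
\<close>

subsection \<open>Closure properties of recursive functions\<close>

text \<open>
  \<open>recursive\<close> is not invariant under changing a function on lists of the wrong length.
\<close>

definition rec_fn :: "nat \<Rightarrow> (nat list \<Rightarrow> nat) \<Rightarrow> bool" where
  "rec_fn n F \<longleftrightarrow> (\<exists>g. recursive n g \<and> (\<forall>xs. length xs = n \<longrightarrow> F xs = g xs))"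

lemma rec_fn_cong: "rec_fn n F \<Longrightarrow> (\<And>xs. length xs = n \<Longrightarrow> F' xs = F xs) \<Longrightarrow> rec_fn n F'"
  by (auto simp: rec_fn_def)

lemma rec_fn_proj: "i < n \<Longrightarrow> rec_fn n (\<lambda>xs. xs ! i)"
  using recursive.proj by (auto simp: rec_fn_def)

lemma rec_fn_comp:
  assumes G: "rec_fn (length hs) G" and hs: "\<And>h. h \<in> set hs \<Longrightarrow> rec_fn n h"
  shows "rec_fn n (\<lambda>xs. G (map (\<lambda>h. h xs) hs))"
proof -
  obtain g where g: "recursive (length hs) g" "\<And>xs. length xs = length hs \<Longrightarrow> G xs = g xs"
    using G by (auto simp: rec_fn_def)
  obtain k where k: "\<And>h. h \<in> set hs \<Longrightarrow> recursive n (k h)"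
    "\<And>h xs. h \<in> set hs \<Longrightarrow> length xs = n \<Longrightarrow> h xs = k h xs"
    using hs unfolding rec_fn_def by metis
  have "recursive n (\<lambda>xs. g (map (\<lambda>h. h xs) (map k hs)))"
    using g(1) k(1) by (intro recursive.comp) auto
  moreover have "G (map (\<lambda>h. h xs) hs) = g (map (\<lambda>h. h xs) (map k hs))" if "length xs = n" for xs
  proof -
    have "map (\<lambda>h. h xs) hs = map (\<lambda>h. h xs) (map k hs)"
      using k(2)[OF _ that] by (simp add: comp_def)
    then show ?thesis by (simp only:) (simp add: g(2))
  qed
  ultimately show ?thesis unfolding rec_fn_def by blast
qed

lemma rec_fn_comp1: "rec_fn 1 G \<Longrightarrow> rec_fn n a \<Longrightarrow> rec_fn n (\<lambda>xs. G [a xs])"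
  using rec_fn_comp[of "[a]" G n] by simp

lemma rec_fn_comp2: "rec_fn 2 G \<Longrightarrow> rec_fn n a \<Longrightarrow> rec_fn n b \<Longrightarrow> rec_fn n (\<lambda>xs. G [a xs, b xs])"
  using rec_fn_comp[of "[a, b]" G n] by (auto simp: numeral_2_eq_2)

lemma rec_fn_comp4:
  "rec_fn 4 G \<Longrightarrow> rec_fn n a \<Longrightarrow> rec_fn n b \<Longrightarrow> rec_fn n c \<Longrightarrow> rec_fn n d \<Longrightarrow> rec_fn n (\<lambda>xs. G [a xs, b xs, c xs, d xs])"
  using rec_fn_comp[of "[a, b, c, d]" G n] by (auto simp: eval_nat_numeral)

lemma rec_fn_prim_rec:
  assumes "rec_fn n G" "rec_fn (Suc (Suc n)) H"
  shows "rec_fn (Suc n) (\<lambda>xs. rec_nat (G (tl xs)) (\<lambda>k r. H (k # r # tl xs)) (hd xs))"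
proof -
  obtain g h where g: "recursive n g" "\<And>xs. length xs = n \<Longrightarrow> G xs = g xs"
    and h: "recursive (Suc (Suc n)) h" "\<And>xs. length xs = Suc (Suc n) \<Longrightarrow> H xs = h xs"
    using assms by (auto simp: rec_fn_def)
  have "rec_nat (G (tl xs)) (\<lambda>k r. H (k # r # tl xs)) m
      = rec_nat (g (tl xs)) (\<lambda>k r. h (k # r # tl xs)) m" if "length xs = Suc n" for xs m
    using that by (induction m) (auto simp: g(2) h(2))
  then show ?thesis
    unfolding rec_fn_def using recursive.prim_rec[OF g(1) h(1)] by blast
qed

text \<open>\<open>recursive.minim\<close> searches for a zero, and \<open>of_bool (Q ys)\<close> is
  zero exactly where \<open>Q\<close> fails. So a condition that is to be searched for enters
  negated.\<close>

lemma rec_fn_Least: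
  assumes Q: "rec_fn (Suc n) (\<lambda>ys. of_bool (Q ys))"
    and total: "\<And>xs. length xs = n \<Longrightarrow> \<exists>y. \<not> Q (y # xs)"
  shows "rec_fn n (\<lambda>xs. LEAST y. \<not> Q (y # xs))"
proof -
  obtain g where g: "recursive (Suc n) g" "\<And>xs. length xs = Suc n \<Longrightarrow> of_bool (Q xs) = g xs"
    using Q by (auto simp: rec_fn_def)
  have iff: "g (y # xs) = 0 \<longleftrightarrow> \<not> Q (y # xs)" if "length xs = n" for y xs
    using g(2)[of "y # xs", symmetric] that by auto
  have "recursive n (\<lambda>xs. LEAST y. g (y # xs) = 0)"
    using total by (intro recursive.minim g) (auto simp: iff)
  then show ?thesis unfolding rec_fn_def by (auto simp: iff)
qed

lemma rec_fn_Suc: assumes "rec_fn n a" shows "rec_fn n (\<lambda>xs. Suc (a xs))"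
proof -
  have "rec_fn 1 (\<lambda>xs. Suc (xs ! 0))" using recursive.succ by (auto simp: rec_fn_def)
  from rec_fn_comp1[OF this assms] show ?thesis by simp
qed

lemma rec_fn_const: "rec_fn n (\<lambda>xs. k)"
proof (induction k)
  case 0
  show ?case using recursive.zero by (auto simp: rec_fn_def)
qed (rule rec_fn_Suc)

lemma length_eq_numeral:
  "length xs = 1 \<longleftrightarrow> (\<exists>x. xs = [x])"
  "length xs = 2 \<longleftrightarrow> (\<exists>x y. xs = [x, y])"
  by (auto simp: length_Suc_conv numeral_2_eq_2)

lemma rec_fn_add: assumes "rec_fn n a" "rec_fn n b" shows "rec_fn n (\<lambda>xs. a xs + b xs)"
proof -
  have "rec_fn (Suc 1) (\<lambda>xs. rec_nat (tl xs ! 0) (\<lambda>k r. Suc ((k # r # tl xs) ! 1)) (hd xs))"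
    by (intro rec_fn_prim_rec[where G = "\<lambda>xs. xs ! 0" and H = "\<lambda>xs. Suc (xs ! 1)"] rec_fn_Suc rec_fn_proj) auto
  moreover have "rec_nat y (\<lambda>k r. Suc r) x = x + y" for x y
    by (induction x) auto
  ultimately have "rec_fn 2 (\<lambda>xs. xs ! 0 + xs ! 1)"
    by (auto simp: length_eq_numeral numeral_2_eq_2[symmetric] elim!: rec_fn_cong)
  from rec_fn_comp2[OF this assms] show ?thesis by simp
qed

lemma rec_fn_mult: assumes "rec_fn n a" "rec_fn n b" shows "rec_fn n (\<lambda>xs. a xs * b xs)"
proof -
  have "rec_fn (Suc 1) (\<lambda>xs. rec_nat 0 (\<lambda>k r. (k # r # tl xs) ! 1 + (k # r # tl xs) ! 2) (hd xs))"
    by (intro rec_fn_prim_rec[where G = "\<lambda>xs. 0" and H = "\<lambda>xs. xs ! 1 + xs ! 2"] rec_fn_add rec_fn_const rec_fn_proj) auto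
  moreover have "rec_nat 0 (\<lambda>k r. r + y) x = x * y" for x y :: nat
    by (induction x) auto
  ultimately have "rec_fn 2 (\<lambda>xs. xs ! 0 * xs ! 1)"
    by (auto simp: length_eq_numeral numeral_2_eq_2[symmetric] elim!: rec_fn_cong)
  from rec_fn_comp2[OF this assms] show ?thesis by simp
qed

lemma rec_fn_diff: assumes "rec_fn n a" "rec_fn n b" shows "rec_fn n (\<lambda>xs. a xs - b xs)"
proof -
  \<comment> \<open>The predecessor function comes first; iterating it gives truncated
    subtraction.\<close>
  have "rec_fn (Suc 0) (\<lambda>xs. rec_nat 0 (\<lambda>k r. (k # r # tl xs) ! 0) (hd xs))"
    by (intro rec_fn_prim_rec[where G = "\<lambda>xs. 0" and H = "\<lambda>xs. xs ! 0"] rec_fn_const rec_fn_proj) auto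
  moreover have "rec_nat 0 (\<lambda>k r. k) x = x - 1" for x :: nat
    by (cases x) auto
  ultimately have "rec_fn 1 (\<lambda>xs. xs ! 0 - 1)"
    by (auto simp: length_Suc_conv elim!: rec_fn_cong)
  from rec_fn_comp1[OF this, of 3 "\<lambda>xs. xs ! 1"] have "rec_fn 3 (\<lambda>xs. xs ! 1 - 1)" by (simp add: rec_fn_proj)
  \<comment> \<open>The recursion runs on the head argument, so the subtrahend has to come first;
    the order is corrected at the end.\<close>
  then have "rec_fn (Suc 1) (\<lambda>xs. rec_nat (tl xs ! 0) (\<lambda>k r. (k # r # tl xs) ! 1 - 1) (hd xs))"
    by (intro rec_fn_prim_rec[where G = "\<lambda>xs. xs ! 0" and H = "\<lambda>xs. xs ! 1 - 1"] rec_fn_proj) (auto simp: eval_nat_numeral)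
  moreover have "rec_nat y (\<lambda>k r. r - 1) x = y - x" for x y :: nat
    by (induction x) auto
  ultimately have "rec_fn 2 (\<lambda>xs. xs ! 1 - xs ! 0)"
    by (auto simp: length_eq_numeral numeral_2_eq_2[symmetric] elim!: rec_fn_cong)
  from rec_fn_comp2[OF this assms(2,1)] show ?thesis by simp
qed

lemma rec_fn_power2: assumes "rec_fn n a" shows "rec_fn n (\<lambda>xs. 2 ^ a xs)"
proof -
  have "rec_fn (Suc 0) (\<lambda>xs. rec_nat 1 (\<lambda>k r. 2 * (k # r # tl xs) ! 1) (hd xs))"
    by (intro rec_fn_prim_rec[where G = "\<lambda>xs. 1" and H = "\<lambda>xs. 2 * xs ! 1"] rec_fn_const rec_fn_mult rec_fn_proj) auto
  moreover have "rec_nat (Suc 0) (\<lambda>k r. 2 * r) x = 2 ^ x" for x :: nat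
    by (induction x) auto
  ultimately have "rec_fn 1 (\<lambda>xs. 2 ^ (xs ! 0))"
    by (auto simp: length_Suc_conv elim!: rec_fn_cong)
  from rec_fn_comp1[OF this assms] show ?thesis by simp
qed

section \<open>Decidable predicates and definition by cases\<close>

definition decidable :: "nat \<Rightarrow> (nat list \<Rightarrow> bool) \<Rightarrow> bool" where
  "decidable n Q \<longleftrightarrow> rec_fn n (\<lambda>xs. of_bool (Q xs))"

lemma decidable_less: assumes "rec_fn n a" "rec_fn n b" shows "decidable n (\<lambda>xs. a xs < b xs)"
proof -
  \<comment> \<open>With truncated subtraction, \<open>1 - (1 - k)\<close> is the sign of
    \<open>k\<close>: zero for \<open>k = 0\<close> and one otherwise.\<close>
  have "rec_fn n (\<lambda>xs. 1 - (1 - (b xs - a xs)))" by (intro rec_fn_diff rec_fn_const assms)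
  then show ?thesis unfolding decidable_def by (rule rec_fn_cong) auto
qed

lemma decidable_not: assumes "decidable n Q" shows "decidable n (\<lambda>xs. \<not> Q xs)"
proof -
  have "rec_fn n (\<lambda>xs. 1 - of_bool (Q xs))" using assms by (intro rec_fn_diff rec_fn_const) (simp add: decidable_def)
  then show ?thesis unfolding decidable_def by (rule rec_fn_cong) auto
qed

lemma decidable_conj:
  assumes "decidable n Q" "decidable n R" shows "decidable n (\<lambda>xs. Q xs \<and> R xs)"
proof -
  have "rec_fn n (\<lambda>xs. of_bool (Q xs) * of_bool (R xs))" using assms by (intro rec_fn_mult) (simp_all add: decidable_def)
  then show ?thesis unfolding decidable_def by (rule rec_fn_cong) auto
qed

lemma decidable_imp:
  assumes "decidable n Q" "decidable n R" shows "decidable n (\<lambda>xs. Q xs \<longrightarrow> R xs)"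
proof -
  have "decidable n (\<lambda>xs. \<not> (Q xs \<and> \<not> R xs))" by (intro decidable_not decidable_conj assms)
  then show ?thesis by simp
qed

lemma decidable_disj:
  assumes "decidable n Q" "decidable n R" shows "decidable n (\<lambda>xs. Q xs \<or> R xs)"
  using decidable_imp[OF decidable_not[OF assms(1)] assms(2)] by (simp add: imp_conv_disj)

lemma rec_fn_if:
  assumes "decidable n Q" "rec_fn n a" "rec_fn n b" shows "rec_fn n (\<lambda>xs. if Q xs then a xs else b xs)"
proof -
  have "rec_fn n (\<lambda>xs. of_bool (Q xs) * a xs + (1 - of_bool (Q xs)) * b xs)"
    using assms by (intro rec_fn_add rec_fn_mult rec_fn_diff rec_fn_const) (simp_all add: decidable_def)
  then show ?thesis by (rule rec_fn_cong) auto
qed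

text \<open>\<open>a div 2\<close> is the least \<open>y\<close> with
  \<open>a < 2 * (y + 1)\<close>; the search terminates because \<open>y = a\<close>
  qualifies.\<close>

lemma rec_fn_div2: assumes "rec_fn n a" shows "rec_fn n (\<lambda>xs. a xs div 2)"
proof -
  have *: "(LEAST y. \<not> (\<lambda>ys. \<not> ys ! 1 < 2 * Suc (ys ! 0)) (y # xs)) = xs ! 0 div 2" for xs
    by (rule Least_equality) auto
  have "rec_fn 1 (\<lambda>xs. LEAST y. \<not> (\<lambda>ys. \<not> ys ! 1 < 2 * Suc (ys ! 0)) (y # xs))"
  proof (rule rec_fn_Least)
    show "rec_fn (Suc 1) (\<lambda>ys. of_bool (\<not> ys ! 1 < 2 * Suc (ys ! 0)))"
      unfolding decidable_def[symmetric]
      by (intro decidable_not decidable_less rec_fn_mult rec_fn_const rec_fn_Suc rec_fn_proj) auto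
    show "\<exists>y. \<not> \<not> (y # xs) ! 1 < 2 * Suc ((y # xs) ! 0)" for xs
      by (rule exI[of _ "xs ! 0"]) simp
  qed
  from rec_fn_comp1[OF this[unfolded *] assms] show ?thesis by simp
qed

lemma decidable_even: assumes "rec_fn n a" shows "decidable n (\<lambda>xs. even (a xs))"
proof -
  have "decidable n (\<lambda>xs. \<not> 2 * (a xs div 2) < a xs)"
    by (intro decidable_not decidable_less rec_fn_mult rec_fn_const rec_fn_div2 assms)
  moreover have "(\<not> 2 * (x div 2) < x) = even x" for x :: nat by presburger
  ultimately show ?thesis by (simp only:)
qed

text \<open>Cantor pairing sends \<open>(m, n)\<close> to \<open>triangle (m + n) + m\<close>, so
  the diagonal \<open>s = m + n\<close> is the least \<open>s\<close> with
  \<open>x < triangle (s + 1)\<close>. This makes decoding accessible to minimization.\<close>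

lemma prod_decode_triangle:
  "prod_decode x = (x - triangle s, s - (x - triangle s))" if s: "s = (LEAST s. x < triangle (Suc s))"
proof -
  obtain m n where x: "x = prod_encode (m, n)" by (metis prod_decode_inverse surj_pair)
  have mono: "triangle i \<le> triangle j" if "i \<le> j" for i j
    using that by (induction j) (auto simp: le_Suc_eq)
  have "s = m + n"
    unfolding s
  proof (rule Least_equality)
    show "x < triangle (Suc (m + n))" by (simp add: x prod_encode_def)
    show "m + n \<le> s" if "x < triangle (Suc s)" for s
      using that mono[of "Suc s" "m + n"] by (fastforce simp: x prod_encode_def not_le)
  qed
  then show ?thesis by (simp add: x) (simp add: prod_encode_def)
qed

lemma rec_fn_prod_decode:
  assumes "rec_fn n a"
  shows "rec_fn n (\<lambda>xs. fst (prod_decode (a xs)))" "rec_fn n (\<lambda>xs. snd (prod_decode (a xs)))"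
proof -
  define s where "s x = (LEAST s. x < triangle (Suc s))" for x
  have tri: "rec_fn m (\<lambda>xs. triangle (b xs))" if "rec_fn m b" for m b
    unfolding triangle_def by (intro rec_fn_div2 rec_fn_mult rec_fn_Suc that)
  have "rec_fn 1 (\<lambda>xs. LEAST y. \<not> (\<lambda>ys. \<not> ys ! 1 < triangle (Suc (ys ! 0))) (y # xs))"
  proof (rule rec_fn_Least)
    show "rec_fn (Suc 1) (\<lambda>ys. of_bool (\<not> ys ! 1 < triangle (Suc (ys ! 0))))"
      unfolding decidable_def[symmetric]
      by (intro decidable_not decidable_less tri rec_fn_Suc rec_fn_proj) auto
    show "\<exists>y. \<not> \<not> (y # xs) ! 1 < triangle (Suc ((y # xs) ! 0))" for xs
      by (rule exI[of _ "xs ! 0"]) simp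
  qed
  then have "rec_fn 1 (\<lambda>xs. s (xs ! 0))" by (simp add: s_def del: triangle_Suc)
  from rec_fn_comp1[OF this assms] have s: "rec_fn n (\<lambda>xs. s (a xs))" by simp
  show "rec_fn n (\<lambda>xs. fst (prod_decode (a xs)))" "rec_fn n (\<lambda>xs. snd (prod_decode (a xs)))"
    unfolding prod_decode_triangle[OF s_def] fst_conv snd_conv
    by (intro rec_fn_diff assms s tri)+
qed

text \<open>Recursive functions take natural values, so a signed numerator is a difference of two of
  them. Positive denominators allow arithmetic by cross-multiplication, without reducing
  fractions.\<close>

definition computable_rat :: "nat \<Rightarrow> (nat list \<Rightarrow> real) \<Rightarrow> bool" where
  "computable_rat n u \<longleftrightarrow> (\<exists>P N D. rec_fn n P \<and> rec_fn n N \<and> rec_fn n D \<and>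
     (\<forall>xs. length xs = n \<longrightarrow> 0 < D xs \<and> u xs = (real (P xs) - real (N xs)) / real (D xs)))"

lemma computable_ratI:
  assumes "rec_fn n P" "rec_fn n N" "rec_fn n D"
    and "\<And>xs. length xs = n \<Longrightarrow> 0 < D xs \<and> u xs = (real (P xs) - real (N xs)) / real (D xs)"
  shows "computable_rat n u"
  using assms unfolding computable_rat_def by blast

text \<open>The code \<open>2 k\<close> stands for the integer \<open>k\<close> and
  \<open>2 k + 1\<close> for \<open>-(k + 1)\<close>. So \<open>Suc a div 2\<close> is the absolute
  value in both cases, and the sign of the quotient depends on whether the parities agree.\<close>

lemma nth_rat_altdef:
  "nth_rat i = (let a = fst (prod_decode i); b = snd (prod_decode i); m = Suc a div 2 in
     (real (if even (a + b) then m else 0) - real (if even (a + b) then 0 else m)) / real (Suc b div 2))"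
proof -
  have dec: "real_of_int (int_decode a) = (if even a then real (Suc a div 2) else - real (Suc a div 2))" for a
    by (auto simp: int_decode_def sum_decode_def elim!: evenE oddE)
  have "real_of_rat (Fract a b) = of_int a / of_int b" for a b
    by (cases "b = 0") (simp_all add: of_rat_rat rat_number_collapse)
  then have "nth_rat i = real_of_int (int_decode (fst (prod_decode i))) / real_of_int (int_decode (snd (prod_decode i)))"
    by (simp add: nth_rat_def nat_to_rat_surj_def case_prod_unfold Let_def)
  then show ?thesis
    unfolding dec Let_def even_add
    by (cases "even (fst (prod_decode i))"; cases "even (snd (prod_decode i))")
      (simp_all del: even_Suc_div_two odd_Suc_div_two)
qed

lemma computable_rat_nth_rat:
  assumes "rec_fn n a" shows "computable_rat n (\<lambda>xs. nth_rat (a xs))"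
proof -
  let ?b = "\<lambda>xs. snd (prod_decode (a xs))"
  let ?m = "\<lambda>xs. Suc (fst (prod_decode (a xs))) div 2"
  let ?even = "\<lambda>xs. even (fst (prod_decode (a xs)) + ?b xs)"
  show ?thesis
  proof (rule computable_ratI)
    \<comment> \<open>Only the code \<open>0\<close> decodes to the denominator \<open>0\<close>.
      Division by zero then yields \<open>0\<close>, which is represented as
      \<open>0 / 1\<close>.\<close>
    show "rec_fn n (\<lambda>xs. if 0 < ?b xs \<and> ?even xs then ?m xs else 0)"
      "rec_fn n (\<lambda>xs. if 0 < ?b xs \<and> \<not> ?even xs then ?m xs else 0)"
      "rec_fn n (\<lambda>xs. if 0 < ?b xs then Suc (?b xs) div 2 else 1)"
      by (intro rec_fn_if decidable_conj decidable_not decidable_even decidable_less rec_fn_div2 rec_fn_add rec_fn_Suc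
          rec_fn_const rec_fn_prod_decode assms)+
  qed (auto simp: nth_rat_altdef Let_def)
qed

lemma computable_rat_diff:
  assumes "computable_rat n u" "computable_rat n v" shows "computable_rat n (\<lambda>xs. u xs - v xs)"
proof -
  obtain P N D where u: "rec_fn n P" "rec_fn n N" "rec_fn n D" "\<And>xs. length xs = n \<Longrightarrow> 0 < D xs"
    "\<And>xs. length xs = n \<Longrightarrow> u xs = (real (P xs) - real (N xs)) / real (D xs)"
    using assms(1) unfolding computable_rat_def by metis
  obtain P' N' D' where v: "rec_fn n P'" "rec_fn n N'" "rec_fn n D'" "\<And>xs. length xs = n \<Longrightarrow> 0 < D' xs"
    "\<And>xs. length xs = n \<Longrightarrow> v xs = (real (P' xs) - real (N' xs)) / real (D' xs)"
    using assms(2) unfolding computable_rat_def by metis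
  show ?thesis
  proof (rule computable_ratI)
    show "rec_fn n (\<lambda>xs. P xs * D' xs + N' xs * D xs)" "rec_fn n (\<lambda>xs. N xs * D' xs + P' xs * D xs)"
      "rec_fn n (\<lambda>xs. D xs * D' xs)"
      by (intro rec_fn_add rec_fn_mult u v)+
    show "0 < D xs * D' xs \<and> u xs - v xs = (real (P xs * D' xs + N' xs * D xs) -
        real (N xs * D' xs + P' xs * D xs)) / real (D xs * D' xs)" if "length xs = n" for xs
      using u(4)[OF that] v(4)[OF that] by (simp add: u(5)[OF that] v(5)[OF that] field_simps)
  qed
qed

lemma computable_rat_mult:
  assumes "computable_rat n u" "computable_rat n v" shows "computable_rat n (\<lambda>xs. u xs * v xs)"
proof -
  obtain P N D where u: "rec_fn n P" "rec_fn n N" "rec_fn n D" "\<And>xs. length xs = n \<Longrightarrow> 0 < D xs"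
    "\<And>xs. length xs = n \<Longrightarrow> u xs = (real (P xs) - real (N xs)) / real (D xs)"
    using assms(1) unfolding computable_rat_def by metis
  obtain P' N' D' where v: "rec_fn n P'" "rec_fn n N'" "rec_fn n D'" "\<And>xs. length xs = n \<Longrightarrow> 0 < D' xs"
    "\<And>xs. length xs = n \<Longrightarrow> v xs = (real (P' xs) - real (N' xs)) / real (D' xs)"
    using assms(2) unfolding computable_rat_def by metis
  show ?thesis
  proof (rule computable_ratI)
    show "rec_fn n (\<lambda>xs. P xs * P' xs + N xs * N' xs)" "rec_fn n (\<lambda>xs. N xs * P' xs + P xs * N' xs)"
      "rec_fn n (\<lambda>xs. D xs * D' xs)"
      by (intro rec_fn_add rec_fn_mult u v)+
    show "0 < D xs * D' xs \<and> u xs * v xs = (real (P xs * P' xs + N xs * N' xs) -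
        real (N xs * P' xs + P xs * N' xs)) / real (D xs * D' xs)" if "length xs = n" for xs
      using u(4)[OF that] v(4)[OF that] by (simp add: u(5)[OF that] v(5)[OF that] field_simps)
  qed
qed

lemma nth_rat_surj: "q \<in> \<rat> \<Longrightarrow> \<exists>i. nth_rat i = q"
  using surj_of_rat_nat_to_rat_surj unfolding nth_rat_def by metis

lemma nth_rat_in_Rats [simp]: "nth_rat i \<in> \<rat>"
  by (simp add: nth_rat_def)

lemma computable_rat_const: assumes "q \<in> \<rat>" shows "computable_rat n (\<lambda>xs. q)"
  using nth_rat_surj[OF assms] computable_rat_nth_rat[OF rec_fn_const] by auto

lemma computable_rat_half_power:
  assumes "rec_fn n a" shows "computable_rat n (\<lambda>xs. 1 / 2 ^ a xs)"
  by (rule computable_ratI[OF rec_fn_const[of n 1] rec_fn_const[of n 0] rec_fn_power2[OF assms]]) auto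

lemma decidable_rat_less:
  assumes "computable_rat n u" "computable_rat n v" shows "decidable n (\<lambda>xs. u xs < v xs)"
proof -
  obtain P N D where w: "rec_fn n P" "rec_fn n N" "rec_fn n D" "\<And>xs. length xs = n \<Longrightarrow> 0 < D xs"
    "\<And>xs. length xs = n \<Longrightarrow> v xs - u xs = (real (P xs) - real (N xs)) / real (D xs)"
    using computable_rat_diff[OF assms(2,1)] unfolding computable_rat_def by metis
  have "u xs < v xs \<longleftrightarrow> N xs < P xs" if "length xs = n" for xs
  proof -
    have "u xs < v xs \<longleftrightarrow> 0 < v xs - u xs" by simp
    also have "\<dots> \<longleftrightarrow> N xs < P xs" using w(4)[OF that] by (simp add: w(5)[OF that] zero_less_divide_iff)
    finally show ?thesis .
  qed
  then show ?thesis
    using decidable_less[OF w(2,1)] unfolding decidable_def by (auto elim!: rec_fn_cong)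
qed

lemma decidable_rat_le:
  assumes "computable_rat n u" "computable_rat n v" shows "decidable n (\<lambda>xs. u xs \<le> v xs)"
  using decidable_not[OF decidable_rat_less[OF assms(2,1)]] by (simp add: not_less)

subsection \<open>A null set lemma for slopes\<close>

text \<open>On the line a closed interval is a closed ball about its midpoint, so this is Vitali's
  theorem for balls; the covered point need not be the centre.\<close>

lemma Vitali_covering_intervals:
  fixes S :: "real set" and K :: "(real \<times> real) set"
  assumes K: "\<And>a b. (a, b) \<in> K \<Longrightarrow> a < b"
    and S: "\<And>x e. x \<in> S \<Longrightarrow> 0 < e \<Longrightarrow> \<exists>a b. (a, b) \<in> K \<and> a \<le> x \<and> x \<le> b \<and> b - a < e"
  obtains C where "countable C" "C \<subseteq> K"
    "pairwise (\<lambda>p q. disjnt {fst p..snd p} {fst q..snd q}) C"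
    "negligible (S - (\<Union>p\<in>C. {fst p..snd p}))"
proof -
  define c where "c p = (fst p + snd p) / 2" for p :: "real \<times> real"
  define r where "r p = (snd p - fst p) / 2" for p :: "real \<times> real"
  have eq: "cball (c p) (r p) = {fst p..snd p}" for p
    by (auto simp: c_def r_def cball_eq_atLeastAtMost field_simps)
  have r: "0 < r p" if "p \<in> K" for p
    using K[of "fst p" "snd p"] that by (simp add: r_def)
  have cov: "\<exists>p. p \<in> K \<and> x \<in> cball (c p) (r p) \<and> r p < e" if x: "x \<in> S" "0 < e" for x e
  proof -
    obtain a b where "(a, b) \<in> K" "a \<le> x" "x \<le> b" "b - a < e"
      using S[OF x] by blast
    moreover from this have "a < b" by (auto dest: K)
    moreover from \<open>a \<le> x\<close> \<open>x \<le> b\<close> have "x \<in> cball (c (a, b)) (r (a, b))"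
      unfolding eq by simp
    ultimately show ?thesis
      by (intro exI[of _ "(a, b)"]) (simp add: r_def)
  qed
  show thesis
    by (rule Vitali_covering_theorem_cballs[OF r cov]) (auto simp: eq intro: that)
qed

text \<open>Countably many disjoint members of \<open>K\<close> cover \<open>S\<close> up to a null
  set, and the measure of their union is controlled by finite subunions. So a bound for finite
  disjoint families suffices.\<close>

lemma measure_le_Vitali_sums:
  fixes S :: "real set" and K :: "(real \<times> real) set"
  assumes meas: "S \<in> lmeasurable"
    and K: "\<And>a b. (a, b) \<in> K \<Longrightarrow> a < b"
    and cover: "\<And>x e. x \<in> S \<Longrightarrow> 0 < e \<Longrightarrow> \<exists>a b. (a, b) \<in> K \<and> a \<le> x \<and> x \<le> b \<and> b - a < e"
    and bound: "\<And>F. finite F \<Longrightarrow> F \<subseteq> K \<Longrightarrow>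
      pairwise (\<lambda>p q. disjnt {fst p..snd p} {fst q..snd q}) F \<Longrightarrow>
      (\<Sum>p\<in>F. measure lebesgue (S \<inter> {fst p..snd p})) \<le> B"
  shows "measure lebesgue S \<le> B"
proof -
  obtain C where C: "countable C" "C \<subseteq> K"
    "pairwise (\<lambda>p q. disjnt {fst p..snd p} {fst q..snd q}) C"
    "negligible (S - (\<Union>p\<in>C. {fst p..snd p}))"
    using Vitali_covering_intervals[of K S] K cover by blast
  let ?I = "\<lambda>p. S \<inter> {fst p..snd p}"
  have I: "?I p \<in> lmeasurable" for p
    using meas by (intro fmeasurable.Int) (auto simp: lmeasurable_interval)
  have fin: "measure lebesgue (\<Union>p\<in>F. ?I p) \<le> B" if "F \<subseteq> C" "finite F" for F
  proof -
    have "measure lebesgue (\<Union>p\<in>F. ?I p) \<le> (\<Sum>p\<in>F. measure lebesgue (?I p))"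
      using that I by (intro measure_UNION_le) auto
    also have "\<dots> \<le> B"
      using that C by (intro bound) (auto intro: pairwise_subset)
    finally show ?thesis .
  qed
  let ?U = "\<Union>p\<in>C. ?I p"
  have U: "?U \<in> lmeasurable" "measure lebesgue ?U \<le> B"
    using fmeasurable_UN_bound[OF C(1) I fin] measure_UN_bound[OF C(1) I fin] by auto
  have "negligible (S - ?U)"
    by (rule negligible_subset[OF C(4)]) auto
  moreover have "?U - S = {}" by auto
  ultimately have "measure lebesgue S = measure lebesgue ?U"
    using U(1) meas by (intro measure_negligible_symdiff[symmetric]) (auto simp: Un_commute)
  with U show ?thesis by simp
qed

text \<open>If \<open>S\<close> had positive measure, it would lie in an open \<open>G\<close> with
  \<open>|G| < |S| / d\<close>. The intervals inside \<open>G\<close> in which \<open>S\<close> has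
  proportion at most \<open>d\<close> still form a Vitali cover, so
  \<open>|S| \<le> d |G| < |S|\<close>.\<close>

lemma negligible_if_small_in_intervals:
  fixes S :: "real set"
  assumes meas: "S \<in> lmeasurable" and "c < 1"
    and cover: "\<And>x e. x \<in> S \<Longrightarrow> 0 < e \<Longrightarrow>
      \<exists>a b. a < x \<and> x < b \<and> b - a < e \<and> measure lebesgue (S \<inter> {a..b}) \<le> c * (b - a)"
  shows "negligible S"
proof -
  \<comment> \<open>\<open>c\<close> need not be positive; the enlarged \<open>d\<close> can be
    divided by and is still below 1.\<close>
  define d where "d = max c (1/2)"
  have d: "0 < d" "d < 1" "c \<le> d" using \<open>c < 1\<close> by (auto simp: d_def)
  let ?m = "measure lebesgue S"
  have "\<not> 0 < ?m"
  proof
    assume m: "0 < ?m"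
    \<comment> \<open>Chosen so that \<open>|G| < |S| + e = |S| / d\<close>.\<close>
    define e where "e = ?m / d - ?m"
    have e: "0 < e" using m d by (simp add: e_def field_simps)
    obtain G where G: "open G" "S \<subseteq> G" "G - S \<in> lmeasurable" "emeasure lebesgue (G - S) < ennreal e"
      using sets_lebesgue_outer_open[OF fmeasurableD[OF meas] e] .
    have "G = S \<union> (G - S)" using G by auto
    with meas G(3) have Gm: "G \<in> lmeasurable" by (metis fmeasurable.Un)
    have "measure lebesgue (G - S) < e"
      using G(3,4) e by (simp add: emeasure_eq_measure2 ennreal_less_iff)
    hence mG: "measure lebesgue G < ?m / d"
      using measurable_measure_Diff[OF Gm fmeasurableD[OF meas] G(2)] by (simp add: e_def)
    define K where "K = {(a, b). a < b \<and> {a..b} \<subseteq> G \<and> measure lebesgue (S \<inter> {a..b}) \<le> d * (b - a)}"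
    have "?m \<le> d * measure lebesgue G"
    proof (rule measure_le_Vitali_sums[OF meas, where K = K])
      show "\<exists>a b. (a, b) \<in> K \<and> a \<le> x \<and> x \<le> b \<and> b - a < e" if x: "x \<in> S" "0 < e" for x e
      proof -
        obtain \<delta> where \<delta>: "\<delta> > 0" "ball x \<delta> \<subseteq> G"
          using G(1,2) x(1) by (meson openE subsetD)
        obtain a b where ab: "a < x" "x < b" "b - a < min e \<delta>"
          "measure lebesgue (S \<inter> {a..b}) \<le> c * (b - a)"
          using cover[OF x(1), of "min e \<delta>"] x(2) \<delta>(1) by auto
        have "{a..b} \<subseteq> ball x \<delta>" using ab by (auto simp: dist_real_def)
        moreover have "measure lebesgue (S \<inter> {a..b}) \<le> d * (b - a)"
          using d(3) ab by (intro order_trans[OF ab(4)] mult_right_mono) auto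
        ultimately have "(a, b) \<in> K" using ab \<delta>(2) by (simp add: K_def)
        with ab show ?thesis by (intro exI[of _ a] exI[of _ b]) simp
      qed
      show "(\<Sum>p\<in>F. measure lebesgue (S \<inter> {fst p..snd p})) \<le> d * measure lebesgue G"
        if F: "finite F" "F \<subseteq> K" "pairwise (\<lambda>p q. disjnt {fst p..snd p} {fst q..snd q}) F" for F
      proof -
        have "(\<Sum>p\<in>F. measure lebesgue (S \<inter> {fst p..snd p}))
            \<le> (\<Sum>p\<in>F. d * measure lebesgue {fst p..snd p})"
          using F(2) by (intro sum_mono) (auto simp: K_def)
        also have "\<dots> = d * (\<Sum>p\<in>F. measure lebesgue {fst p..snd p})"
          by (simp add: sum_distrib_left)
        also have "(\<Sum>p\<in>F. measure lebesgue {fst p..snd p}) = measure lebesgue (\<Union>p\<in>F. {fst p..snd p})"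
          using F(1,3)
          by (intro measure_UNION_AE[symmetric] pairwise_mono[OF F(3)] AE_I2)
            (auto simp: disjnt_iff lmeasurable_interval)
        also have "\<dots> \<le> measure lebesgue G"
          using F(1,2) Gm by (intro measure_mono_fmeasurable) (fastforce simp: K_def)+
        finally show ?thesis using d(1) by simp
      qed
    qed (auto simp: K_def)
    with mG d(1) show False by (simp add: field_simps)
  qed
  hence "?m = 0" by (simp add: order_antisym not_less)
  thus ?thesis using meas by (simp add: negligible_iff_measure)
qed

text \<open>
  A point of \<open>P\<close> strictly between two points makes \<open>f\<close> comparable there. As nothing separates
  consecutive intervals, \<open>f\<close> at the right end of one is only compared with \<open>f\<close> at the left end of
  the next but one: the two chains cost the factor 2.
\<close>

lemma sum_increments_le:
  fixes f e :: "real \<Rightarrow> real"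
  assumes mono: "\<And>x a b. x \<in> P \<Longrightarrow> a \<in> D \<Longrightarrow> b \<in> D \<Longrightarrow> l \<le> a \<Longrightarrow> b \<le> m \<Longrightarrow> a < x \<Longrightarrow> x < b \<Longrightarrow> f a \<le> f b"
    and p': "p' \<in> P" "p' < m"
    and D: "m \<in> D"
    and "finite A"
    and A: "\<And>a. a \<in> A \<Longrightarrow> a \<in> D \<and> e a \<in> D \<and> e a < p' \<and> (\<exists>x\<in>P. a < x \<and> x < e a)"
    and dis: "\<And>a b. a \<in> A \<Longrightarrow> b \<in> A \<Longrightarrow> a < b \<Longrightarrow> e a < b"
    and uv: "u \<in> D" "v \<in> D" "l \<le> u" "l \<le> v" "v < p'"
      "x \<in> P" "u < x" "x \<le> p'" "\<And>a. a \<in> A \<Longrightarrow> x < a" "\<And>a. a \<in> A \<Longrightarrow> v < a"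
  shows "(\<Sum>a\<in>A. f (e a) - f a) \<le> 2 * f m - f u - f v"
  using \<open>finite A\<close> A dis uv
proof (induction A arbitrary: u v x rule: finite_linorder_min_induct)
  case empty
  \<comment> \<open>Both chains end at \<open>m\<close>; the point \<open>p'\<close> separates it
    from \<open>u\<close> and from \<open>v\<close>.\<close>
  have "f u \<le> f m" "f v \<le> f m" using mono[OF p'(1) _ D] p' empty by auto
  then show ?case by simp
next
  case (insert a A)
  obtain y where y: "y \<in> P" "a < y" "y < e a"
    and a: "a \<in> D" "e a \<in> D" "e a < p'" using insert.prems(1)[of a] by auto
  have va: "v < a" "x < a" using insert.prems by auto
  have order: "l \<le> a" "l \<le> e a" "a \<le> m" "v < y" "y \<le> p'" "v < e a"
    using y a(3) p'(2) va(1) insert.prems(6) by linarith+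
  have "f u \<le> f a"
    using insert.prems va a(1) order by (intro mono[of x u a]) simp_all
  \<comment> \<open>The chains swap roles: \<open>y\<close> separates \<open>v\<close> from the
    remaining left ends, so \<open>v\<close> is compared next, while \<open>e a\<close> waits in its
    place.\<close>
  have "(\<Sum>a\<in>A. f (e a) - f a) \<le> 2 * f m - f v - f (e a)"
  proof (rule insert.IH[of v "e a" y])
    fix b assume "b \<in> A"
    with insert.hyps have "a < b" by auto
    with insert.prems(2)[of a b] \<open>b \<in> A\<close> show "e a < b" by simp
    with y show "y < b" by simp
  qed (use insert.prems y a order in simp_all)
  moreover have "a \<notin> A" using insert.hyps by auto
  ultimately show ?case
    using \<open>f u \<le> f a\<close> insert.hyps by simp
qed

text \<open>Disjoint intervals with slope above \<open>r\<close> have total length at most their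
  total increment divided by \<open>r\<close>, which \<open>sum_increments_le\<close> bounds. That
  lemma needs points of \<open>P\<close> on both sides of the family, so the estimate is first made
  between two points \<open>p\<close> and \<open>p'\<close> of \<open>P\<close>; these then approach
  the infimum and the supremum of \<open>P\<close> inside \<open>(l, m)\<close>.\<close>

lemma measure_le_if_large_increments:
  fixes f :: "real \<Rightarrow> real"
  assumes meas: "P \<in> lmeasurable" and D: "l \<in> D" "m \<in> D" "l < m" and "0 < r"
    and mono: "\<And>x a b. x \<in> P \<Longrightarrow> a \<in> D \<Longrightarrow> b \<in> D \<Longrightarrow> l \<le> a \<Longrightarrow> b \<le> m \<Longrightarrow> a < x \<Longrightarrow> x < b \<Longrightarrow> f a \<le> f b"
    and hi: "\<And>x e. x \<in> P \<Longrightarrow> 0 < e \<Longrightarrow>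
      \<exists>a b. a \<in> D \<and> b \<in> D \<and> a < x \<and> x < b \<and> b - a < e \<and> r * (b - a) < f b - f a"
    and P: "P \<inter> {l<..<m} \<noteq> {}"
  shows "measure lebesgue (P \<inter> {l..m}) \<le> 2 * (f m - f l) / r"
proof (rule field_le_epsilon)
  define B where "B = 2 * (f m - f l) / r"
  have main: "measure lebesgue (P \<inter> {p<..<p'}) \<le> B"
    if p: "p \<in> P" "p' \<in> P" "l < p" "p' < m" "p \<le> p'" for p p'
  proof (rule measure_le_Vitali_sums)
    define K where "K = {(a, b). a \<in> D \<and> b \<in> D \<and> p < a \<and> b < p' \<and>
      r * (b - a) < f b - f a \<and> (\<exists>x\<in>P. a < x \<and> x < b)}"
    show "P \<inter> {p<..<p'} \<in> lmeasurable"
      using meas by (intro fmeasurable.Int) (auto simp: lmeasurable_interval)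
    show "a < b" if "(a, b) \<in> K" for a b using that by (auto simp: K_def)
    show "\<exists>a b. (a, b) \<in> K \<and> a \<le> x \<and> x \<le> b \<and> b - a < e"
      if x: "x \<in> P \<inter> {p<..<p'}" "0 < e" for x e
    proof -
      \<comment> \<open>An interval around \<open>x\<close> shorter than the distances to
        \<open>p\<close> and \<open>p'\<close> stays strictly between them.\<close>
      obtain a b where ab: "a \<in> D" "b \<in> D" "a < x" "x < b" "b - a < min e (min (x - p) (p' - x))"
         "r * (b - a) < f b - f a"
        using hi[of x "min e (min (x - p) (p' - x))"] x by auto
      with x show ?thesis by (intro exI[of _ a] exI[of _ b]) (auto simp: K_def)
    qed
    show "(\<Sum>q\<in>F. measure lebesgue (P \<inter> {p<..<p'} \<inter> {fst q..snd q})) \<le> B"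
      if F: "finite F" "F \<subseteq> K" "pairwise (\<lambda>p q. disjnt {fst p..snd p} {fst q..snd q}) F" for F
    proof -
      have lt: "fst q < snd q" if "q \<in> F" for q using that F(2) by (auto simp: K_def)
      have dj: "snd q < fst q'" if "q \<in> F" "q' \<in> F" "fst q < fst q'" for q q'
      proof (rule ccontr)
        assume "\<not> ?thesis"
        hence "fst q' \<in> {fst q..snd q}" "fst q' \<in> {fst q'..snd q'}" using that lt[of q'] by auto
        with that F(3) show False by (fastforce simp: pairwise_def disjnt_def)
      qed
      have inj: "inj_on fst F"
      proof (rule inj_onI, rule ccontr)
        fix q q' assume q: "q \<in> F" "q' \<in> F" "fst q = fst q'" "q \<noteq> q'"
        hence "fst q \<in> {fst q..snd q}" "fst q \<in> {fst q'..snd q'}" using lt[of q] lt[of q'] by auto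
        with pairwiseD[OF F(3) q(1,2,4)] show False by (auto simp: disjnt_iff)
      qed
      \<comment> \<open>As left ends are distinct by \<open>inj\<close>, the right end is a function
        of the left one, the form in which \<open>sum_increments_le\<close> describes a
        family.\<close>
      define e where "e a = snd (the_inv_into F fst a)" for a
      have e: "e (fst q) = snd q" if "q \<in> F" for q
        using the_inv_into_f_f[OF inj that] by (simp add: e_def)
      have "(\<Sum>q\<in>F. measure lebesgue (P \<inter> {p<..<p'} \<inter> {fst q..snd q}))
          \<le> (\<Sum>q\<in>F. (f (snd q) - f (fst q)) / r)"
      proof (rule sum_mono)
        fix q assume q: "q \<in> F"
        have "measure lebesgue (P \<inter> {p<..<p'} \<inter> {fst q..snd q}) \<le> measure lebesgue {fst q..snd q}"
          using meas by (intro measure_mono_fmeasurable sets.Int) auto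
        also have "\<dots> = snd q - fst q" using lt[OF q] by simp
        also have "\<dots> \<le> (f (snd q) - f (fst q)) / r"
          using q F(2) \<open>0 < r\<close> by (auto simp: K_def field_simps)
        finally show "measure lebesgue (P \<inter> {p<..<p'} \<inter> {fst q..snd q}) \<le> (f (snd q) - f (fst q)) / r" .
      qed
      also have "\<dots> = (\<Sum>a\<in>fst ` F. f (e a) - f a) / r"
        using inj by (simp add: sum.reindex e sum_divide_distrib)
      \<comment> \<open>Both chains start at \<open>l\<close>, and \<open>p\<close> is the first
        separating point.\<close>
      also have "\<dots> \<le> (2 * f m - f l - f l) / r"
      proof (intro divide_right_mono sum_increments_le[where P = P and D = D and l = l and p' = p' and x = p])
        show "a \<in> D \<and> e a \<in> D \<and> e a < p' \<and> (\<exists>x\<in>P. a < x \<and> x < e a)" if "a \<in> fst ` F" for a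
        proof -
          from that obtain b where b: "(a, b) \<in> F" by auto
          with F(2) have "(a, b) \<in> K" by auto
          with e[OF b] show ?thesis by (simp add: K_def)
        qed
        show "e a < b" if "a \<in> fst ` F" "b \<in> fst ` F" "a < b" for a b
        proof -
          from that obtain q q' where "q \<in> F" "q' \<in> F" "a = fst q" "b = fst q'" by auto
          with that dj[of q q'] show ?thesis by (simp add: e)
        qed
        show "p < a" if "a \<in> fst ` F" for a
          using that F(2) by (auto simp: K_def)
        show "l < a" if "a \<in> fst ` F" for a
          using that F(2) p by (fastforce simp: K_def)
      qed (use mono p D F(1) \<open>0 < r\<close> in auto)
      finally show ?thesis by (simp add: B_def)
    qed
  qed
  fix \<epsilon> :: real assume \<epsilon>: "0 < \<epsilon>"
  define Q where "Q = P \<inter> {l<..<m}"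
  have Q: "Q \<noteq> {}" "bdd_above Q" "bdd_below Q" using P by (auto simp: Q_def intro: bdd_belowI bdd_aboveI less_imp_le)
  obtain p where p: "p \<in> Q" "p < Inf Q + \<epsilon> / 2"
    using cInf_lessD[OF Q(1), of "Inf Q + \<epsilon> / 2"] \<epsilon> by auto
  obtain p' where p': "p' \<in> Q" "Sup Q - \<epsilon> / 2 < p'"
    using less_cSupD[OF Q(1), of "Sup Q - \<epsilon> / 2"] \<epsilon> by auto
  \<comment> \<open>The order of \<open>p\<close> and \<open>p'\<close> is unknown, so
    \<open>min\<close> and \<open>max\<close> are used to make \<open>main\<close> applicable. Each
    of the two end pieces is shorter than half of \<open>\<epsilon>\<close>.\<close>
  have sub: "P \<inter> {l..m} \<subseteq> {l} \<union> {m} \<union> (P \<inter> {min p p'<..<max p p'}) \<union> ({Inf Q..p} \<union> {p'..Sup Q})"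
  proof
    fix x assume x: "x \<in> P \<inter> {l..m}"
    show "x \<in> {l} \<union> {m} \<union> (P \<inter> {min p p'<..<max p p'}) \<union> ({Inf Q..p} \<union> {p'..Sup Q})"
    proof (cases "x = l \<or> x = m")
      case False
      with x have "x \<in> Q" by (auto simp: Q_def)
      then have "Inf Q \<le> x" "x \<le> Sup Q" using Q by (auto intro: cInf_lower cSup_upper)
      with x show ?thesis by auto
    qed auto
  qed
  let ?M = "P \<inter> {min p p'<..<max p p'}"
  have M: "?M \<in> lmeasurable"
    using meas by (intro fmeasurable.Int) (auto simp: lmeasurable_interval)
  have sing: "{a} \<in> lmeasurable" for a :: real
    using lmeasurable_interval(1)[of a a] by simp
  have "measure lebesgue (P \<inter> {l..m}) \<le>
      measure lebesgue ({l} \<union> {m} \<union> ?M \<union> ({Inf Q..p} \<union> {p'..Sup Q}))"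
    using meas by (intro measure_mono_fmeasurable[OF sub] fmeasurable.Un M sing) auto
  also have "\<dots> \<le> measure lebesgue ({l} \<union> {m} \<union> ?M) + measure lebesgue ({Inf Q..p} \<union> {p'..Sup Q})"
    by (intro measure_Un_le sets.Un fmeasurableD[OF M] fmeasurableD[OF sing]) auto
  also have "measure lebesgue ({l} \<union> {m} \<union> ?M) \<le> measure lebesgue ({l} \<union> {m}) + measure lebesgue ?M"
    by (intro measure_Un_le sets.Un fmeasurableD[OF M] fmeasurableD[OF sing])
  also have "measure lebesgue ({l} \<union> {m}) \<le> measure lebesgue {l} + measure lebesgue {m}"
    by (intro measure_Un_le) auto
  also have "measure lebesgue ({Inf Q..p} \<union> {p'..Sup Q}) \<le>
      measure lebesgue {Inf Q..p} + measure lebesgue {p'..Sup Q}"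
    by (intro measure_Un_le) auto
  also have "\<dots> = p - Inf Q + (Sup Q - p')"
    using Q p(1) p'(1) cInf_lower[of p Q] cSup_upper[of p' Q] by simp
  also have "measure lebesgue ?M \<le> B"
    using p(1) p'(1) by (intro main) (auto simp: Q_def min_def max_def)
  finally show "measure lebesgue (P \<inter> {l..m}) \<le> 2 * (f m - f l) / r + \<epsilon>"
    using p(2) p'(2) by (simp add: B_def)
qed

text \<open>Subtracting \<open>t * y\<close> turns \<open>low\<close> into monotonicity across
  points of \<open>P\<close>, and the thresholds \<open>q\<close> and \<open>r\<close> into
  \<open>q - t\<close> and \<open>r - t\<close>. In short intervals of slope below \<open>q\<close>
  the set \<open>P\<close> then has proportion at most \<open>2 * (q - t) / (r - t)\<close>, which
  \<open>gap\<close> makes less than 1.\<close>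

lemma negligible_slope_gap:
  fixes \<phi> :: "real \<Rightarrow> real"
  assumes meas: "P \<in> lmeasurable" and h: "0 < h" and gap: "2 * (q - t) < r - t"
    and low: "\<And>x a b. x \<in> P \<Longrightarrow> a \<in> D \<Longrightarrow> b \<in> D \<Longrightarrow> a < x \<Longrightarrow> x < b \<Longrightarrow> b - a < h \<Longrightarrow> t * (b - a) \<le> \<phi> b - \<phi> a"
    and mid: "\<And>x e. x \<in> P \<Longrightarrow> 0 < e \<Longrightarrow>
      \<exists>a b. a \<in> D \<and> b \<in> D \<and> a < x \<and> x < b \<and> b - a < e \<and> \<phi> b - \<phi> a < q * (b - a)"
    and hi: "\<And>x e. x \<in> P \<Longrightarrow> 0 < e \<Longrightarrow>
      \<exists>a b. a \<in> D \<and> b \<in> D \<and> a < x \<and> x < b \<and> b - a < e \<and> r * (b - a) < \<phi> b - \<phi> a"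
  shows "negligible P"
proof (cases "P = {}")
  case False
  then obtain x where "x \<in> P" by auto
  \<comment> \<open>An interval to which \<open>low\<close> and \<open>mid\<close> both apply forces
    \<open>t < q\<close>; with \<open>gap\<close> this makes \<open>r - t\<close> positive.\<close>
  from mid[OF this h] obtain a b where "a \<in> D" "b \<in> D" "a < x" "x < b" "b - a < h" "\<phi> b - \<phi> a < q * (b - a)"
    by auto
  with low[OF \<open>x \<in> P\<close>, of a b] have "t * (b - a) < q * (b - a)" by linarith
  with \<open>a < x\<close> \<open>x < b\<close> have "t < q" by (intro mult_right_less_imp_less[of t "b - a"]) auto
  with gap have r: "0 < r - t" by simp
  define f where "f y = \<phi> y - t * y" for y
  show ?thesis
  proof (rule negligible_if_small_in_intervals[OF meas, of "2 * (q - t) / (r - t)"])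
    show "2 * (q - t) / (r - t) < 1" using gap r by simp
    fix x e :: real assume x: "x \<in> P" "0 < e"
    obtain l m where lm: "l \<in> D" "m \<in> D" "l < x" "x < m" "m - l < min e h" "\<phi> m - \<phi> l < q * (m - l)"
      using mid[OF x(1), of "min e h"] x h by auto
    have "measure lebesgue (P \<inter> {l..m}) \<le> 2 * (f m - f l) / (r - t)"
    proof (rule measure_le_if_large_increments[OF meas lm(1,2) _ r])
      show "f a \<le> f b" if "y \<in> P" "a \<in> D" "b \<in> D" "l \<le> a" "b \<le> m" "a < y" "y < b" for y a b
        using low[OF that(1-3,6,7)] that lm by (simp add: f_def algebra_simps)
      show "\<exists>a b. a \<in> D \<and> b \<in> D \<and> a < y \<and> y < b \<and> b - a < e \<and> (r - t) * (b - a) < f b - f a"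
        if "y \<in> P" "0 < e" for y e
        using hi[OF that] by (simp add: f_def algebra_simps)
    qed (use lm x in auto)
    also have "\<dots> \<le> 2 * ((q - t) * (m - l)) / (r - t)"
      using lm r by (intro divide_right_mono mult_left_mono) (auto simp: f_def algebra_simps)
    also have "\<dots> = 2 * (q - t) / (r - t) * (m - l)" by simp
    finally show "\<exists>a b. a < x \<and> x < b \<and> b - a < e \<and>
        measure lebesgue (P \<inter> {a..b}) \<le> 2 * (q - t) / (r - t) * (b - a)"
      using lm by auto
  qed
qed auto

subsection \<open>Effective classes defined by slopes\<close>

lemma computable2_iff_rc: "computable2 F \<longleftrightarrow> rec_fn 2 (\<lambda>xs. F (xs ! 0) (xs ! 1))"
proof -
  have "(\<forall>x y. F x y = g [x, y]) \<longleftrightarrow> (\<forall>xs. length xs = 2 \<longrightarrow> F (xs ! 0) (xs ! 1) = g xs)" for g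
    unfolding length_eq_numeral by (metis nth_Cons_0 nth_Cons_Suc One_nat_def)
  then show ?thesis by (simp add: computable2_def rec_fn_def)
qed

lemma rec_fn_computable2:
  assumes "computable2 F" "rec_fn n a" "rec_fn n b" shows "rec_fn n (\<lambda>xs. F (a xs) (b xs))"
  using rec_fn_comp2[OF assms(1)[unfolded computable2_iff_rc] assms(2,3)] by simp

text \<open>The number \<open>k\<close> is a witness that reduces a semidecidable condition to a
  decidable one. A single index \<open>m\<close> codes the triple \<open>(i, j, k)\<close>.\<close>

lemma uniformly_Sigma01I:
  assumes R: "decidable 4 R"
  shows "uniformly_Sigma01 (\<lambda>n. {x. \<exists>i j k. R [n, i, j, k] \<and> nth_rat i < x \<and> x < nth_rat j})"
proof -
  define I where "I m = fst (prod_decode m)" for m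
  define J where "J m = fst (prod_decode (snd (prod_decode m)))" for m
  define K where "K m = snd (prod_decode (snd (prod_decode m)))" for m
  have IJK: "rec_fn 2 (\<lambda>xs. I (xs ! 1))" "rec_fn 2 (\<lambda>xs. J (xs ! 1))" "rec_fn 2 (\<lambda>xs. K (xs ! 1))"
    unfolding I_def J_def K_def by (intro rec_fn_prod_decode rec_fn_proj; simp)+
  have R2: "decidable 2 (\<lambda>xs. R [xs ! 0, I (xs ! 1), J (xs ! 1), K (xs ! 1)])"
    unfolding decidable_def
    by (rule rec_fn_comp4[OF R[unfolded decidable_def] _ IJK]) (simp add: rec_fn_proj)
  \<comment> \<open>A triple that fails the test contributes an interval with equal endpoints, which
    is empty.\<close>
  define a where "a n m = (if R [n, I m, J m, K m] then I m else 0)" for n m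
  define b where "b n m = (if R [n, I m, J m, K m] then J m else 0)" for n m
  have "computable2 a" "computable2 b"
    unfolding computable2_iff_rc a_def b_def by (intro rec_fn_if R2 IJK rec_fn_const)+
  moreover have "{x. \<exists>i j k. R [n, i, j, k] \<and> nth_rat i < x \<and> x < nth_rat j} =
      (\<Union>m. {nth_rat (a n m)<..<nth_rat (b n m)})" (is "?L = ?R") for n
  proof
    show "?L \<subseteq> ?R"
    proof
      fix x assume "x \<in> ?L"
      then obtain i j k where ijk: "R [n, i, j, k]" "nth_rat i < x" "x < nth_rat j" by auto
      then have "x \<in> {nth_rat (a n m)<..<nth_rat (b n m)}" if "m = prod_encode (i, prod_encode (j, k))" for m
        by (simp add: a_def b_def I_def J_def K_def that)
      then show "x \<in> ?R" by blast
    qed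
    show "?R \<subseteq> ?L" by (auto simp: a_def b_def split: if_splits) blast
  qed
  ultimately show ?thesis unfolding uniformly_Sigma01_def by blast
qed

section \<open>Construction and closure properties of \<open>\<Pi>\<^sup>0\<^sub>2\<close>
  classes\<close>

lemma Pi02_classI:
  assumes "decidable 4 R"
  shows "Pi02_class {x. \<forall>n. \<exists>i j k. R [n, i, j, k] \<and> nth_rat i < x \<and> x < nth_rat j}"
  unfolding Pi02_class_def
  by (rule exI, rule conjI, rule uniformly_Sigma01I[OF assms])
    (simp add: Collect_all_eq)

text \<open>The two sequences of open sets are interleaved, one at the even and the other at the odd
  indices.\<close>

lemma Pi02_class_Int:
  assumes "Pi02_class P" "Pi02_class Q" shows "Pi02_class (P \<inter> Q)"
proof -
  obtain U a b where U: "P = (\<Inter>n. U n)" "computable2 a" "computable2 b"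
    "\<And>n. U n = (\<Union>m. {nth_rat (a n m)<..<nth_rat (b n m)})"
    using assms(1) unfolding Pi02_class_def uniformly_Sigma01_def by auto
  obtain V c d where V: "Q = (\<Inter>n. V n)" "computable2 c" "computable2 d"
    "\<And>n. V n = (\<Union>m. {nth_rat (c n m)<..<nth_rat (d n m)})"
    using assms(2) unfolding Pi02_class_def uniformly_Sigma01_def by auto
  define W where "W n = (if even n then U (n div 2) else V (n div 2))" for n
  have mix: "computable2 (\<lambda>n m. if even n then F (n div 2) m else G (n div 2) m)"
    if "computable2 F" "computable2 G" for F G
    unfolding computable2_iff_rc
    by (intro rec_fn_if decidable_even rec_fn_computable2[OF that(1)] rec_fn_computable2[OF that(2)] rec_fn_div2 rec_fn_proj) simp_all
  have "uniformly_Sigma01 W"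
    unfolding uniformly_Sigma01_def
    by (rule exI, rule exI, intro conjI, rule mix[OF U(2) V(2)], rule mix[OF U(3) V(3)])
      (simp add: W_def U(4) V(4))
  moreover have "P \<inter> Q = (\<Inter>n. W n)"
  proof
    show "P \<inter> Q \<subseteq> (\<Inter>n. W n)" by (auto simp: W_def U(1) V(1))
    have "W (2 * n) = U n" "W (2 * n + 1) = V n" for n by (simp_all add: W_def)
    then show "(\<Inter>n. W n) \<subseteq> P \<inter> Q" unfolding U(1) V(1) by blast
  qed
  ultimately show ?thesis unfolding Pi02_class_def by blast
qed

lemma uniformly_Sigma01_open: "uniformly_Sigma01 U \<Longrightarrow> open (U n)"
  by (auto simp: uniformly_Sigma01_def intro!: open_UN)

lemma Pi02_class_borel: assumes "Pi02_class P" shows "P \<in> sets borel"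
proof -
  obtain U where "uniformly_Sigma01 U" and P: "P = (\<Inter>n. U n)"
    using assms by (auto simp: Pi02_class_def)
  then have "U n \<in> sets borel" for n
    by (intro borel_open uniformly_Sigma01_open)
  then show ?thesis unfolding P by (intro sets.countable_INT'') simp_all
qed

text \<open>Supplies the open rational intervals that exhaust the complement of a closed
  interval.\<close>

lemma rat_interval_avoiding:
  fixes x a b :: real
  assumes "x < a \<or> b < x"
  shows "\<exists>i j. nth_rat i < x \<and> x < nth_rat j \<and> (nth_rat j \<le> a \<or> b \<le> nth_rat i)"
proof -
  from assms obtain c d where cd: "c < x" "x < d" "d \<le> a \<or> b \<le> c"
    by (metis lt_ex gt_ex order_refl)
  obtain p q where "p \<in> \<rat>" "q \<in> \<rat>" "c < p" "p < x" "x < q" "q < d"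
    using cd Rats_dense_in_real by metis
  moreover obtain i j where "nth_rat i = p" "nth_rat j = q"
    using nth_rat_surj \<open>p \<in> \<rat>\<close> \<open>q \<in> \<rat>\<close> by metis
  ultimately show ?thesis using cd by (intro exI[of _ i] exI[of _ j]) auto
qed

lemma half_power_less: "0 < (e::real) \<Longrightarrow> \<exists>n. 1 / 2 ^ n < e"
  using real_arch_pow_inv[of e "1/2"] by (simp add: power_one_over)

text \<open>The \<open>n\<close>th open set is the union of the rational intervals around
  \<open>z\<close> shorter than \<open>1 / 2 ^ n\<close>.\<close>

lemma Pi02_class_rational: assumes "z \<in> \<rat>" shows "Pi02_class {z}"
proof -
  let ?R = "\<lambda>xs. nth_rat (xs ! 1) < z \<and> z < nth_rat (xs ! 2) \<and>
    nth_rat (xs ! 2) - nth_rat (xs ! 1) < 1 / 2 ^ (xs ! 0)"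
  have "decidable 4 ?R"
    by (intro decidable_conj decidable_rat_less computable_rat_diff computable_rat_nth_rat
        computable_rat_half_power computable_rat_const rec_fn_proj assms) auto
  from Pi02_classI[OF this]
  have "Pi02_class {x. \<forall>n. \<exists>i j k. ?R [n, i, j, k] \<and> nth_rat i < x \<and> x < nth_rat j}" .
  also have "{x. \<forall>n. \<exists>i j k. ?R [n, i, j, k] \<and> nth_rat i < x \<and> x < nth_rat j} = {z}"
  proof (intro equalityI subsetI)
    fix x assume "x \<in> {z}"
    have "\<exists>i j. nth_rat i < z \<and> z < nth_rat j \<and> nth_rat j - nth_rat i < 1 / 2 ^ n" for n
    proof -
      define e :: real where "e = 1 / 2 ^ n / 2"
      have "0 < e" by (simp add: e_def)
      then obtain p q where pq: "p \<in> \<rat>" "q \<in> \<rat>" "z - e < p" "p < z" "z < q" "q < z + e"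
        using Rats_dense_in_real[of "z - e" z] Rats_dense_in_real[of z "z + e"] by auto
      moreover obtain i j where "nth_rat i = p" "nth_rat j = q"
        using nth_rat_surj pq by metis
      ultimately show ?thesis by (intro exI[of _ i] exI[of _ j]) (auto simp: e_def)
    qed
    with \<open>x \<in> {z}\<close> show "x \<in> {x. \<forall>n. \<exists>i j k. ?R [n, i, j, k] \<and> nth_rat i < x \<and> x < nth_rat j}"
      by simp blast
  next
    fix x assume x: "x \<in> {x. \<forall>n. \<exists>i j k. ?R [n, i, j, k] \<and> nth_rat i < x \<and> x < nth_rat j}"
    have "\<bar>x - z\<bar> < 1 / 2 ^ n" for n
    proof -
      from x obtain i j k where "?R [n, i, j, k]" "nth_rat i < x" "x < nth_rat j" by blast
      then show ?thesis by (auto simp: abs_less_iff)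
    qed
    then have "\<not> 0 < \<bar>x - z\<bar>" using half_power_less[of "\<bar>x - z\<bar>"] by (meson less_asym)
    then show "x \<in> {z}" by simp
  qed
  finally show ?thesis .
qed

text \<open>Guarantees that \<open>z\<close> is never an endpoint of a slope, so the weak
  inequalities in the pseudo-derivatives can be made strict and open intervals suffice.\<close>

lemma weakly_2_random_irrational: assumes "weakly_2_random z" shows "z \<notin> \<rat>"
proof
  assume "z \<in> \<rat>"
  then have "Pi02_class {z}" by (rule Pi02_class_rational)
  moreover have "{z} \<in> null_sets lborel" by (rule finite_imp_null_set_lborel) simp
  ultimately show False using assms by (auto simp: weakly_2_random_def)
qed

text \<open>
  The term \<open>2 * (1 / 2 ^ k)\<close> absorbs the errors of the two approximations, so that the strict
  inequality between the true values is witnessed at some precision \<open>k\<close>.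
\<close>

definition certified :: "(nat \<Rightarrow> nat \<Rightarrow> nat) \<Rightarrow> real \<Rightarrow> real \<Rightarrow> nat \<Rightarrow> nat \<Rightarrow> nat \<Rightarrow> bool" where
  "certified g \<sigma> q i j k \<longleftrightarrow> 0 \<le> nth_rat i \<and> nth_rat i < nth_rat j \<and> nth_rat j \<le> 1 \<and>
     \<sigma> * (nth_rat (g j k) - nth_rat (g i k)) < q * (nth_rat j - nth_rat i) - 2 * (1 / 2 ^ k)"

lemma decidable_certified:
  assumes "computable2 g" "\<sigma> \<in> \<rat>" "q \<in> \<rat>" "rec_fn n a" "rec_fn n b" "rec_fn n c"
  shows "decidable n (\<lambda>xs. certified g \<sigma> q (a xs) (b xs) (c xs))"
proof -
  have nth: "computable_rat n (\<lambda>xs. nth_rat (a xs))" "computable_rat n (\<lambda>xs. nth_rat (b xs))"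
    by (rule computable_rat_nth_rat; fact)+
  have app: "computable_rat n (\<lambda>xs. nth_rat (g (a xs) (c xs)))" "computable_rat n (\<lambda>xs. nth_rat (g (b xs) (c xs)))"
    by (rule computable_rat_nth_rat, rule rec_fn_computable2; fact)+
  have const: "computable_rat n (\<lambda>xs. \<sigma>)" "computable_rat n (\<lambda>xs. q)" "computable_rat n (\<lambda>xs. 0)"
    "computable_rat n (\<lambda>xs. 1)" "computable_rat n (\<lambda>xs. 2)"
    using assms by (auto intro: computable_rat_const)
  have lhs: "computable_rat n (\<lambda>xs. \<sigma> * (nth_rat (g (b xs) (c xs)) - nth_rat (g (a xs) (c xs))))"
    by (rule computable_rat_mult[OF const(1) computable_rat_diff[OF app(2,1)]])
  have rhs: "computable_rat n (\<lambda>xs. q * (nth_rat (b xs) - nth_rat (a xs)) - 2 * (1 / 2 ^ c xs))"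
    by (rule computable_rat_diff[OF computable_rat_mult[OF const(2) computable_rat_diff[OF nth(2,1)]]
      computable_rat_mult[OF const(5) computable_rat_half_power[OF assms(6)]]])
  show ?thesis
    unfolding certified_def
    by (rule decidable_conj[OF decidable_rat_le[OF const(3) nth(1)] decidable_conj[OF decidable_rat_less[OF nth(1,2)]
      decidable_conj[OF decidable_rat_le[OF nth(2) const(4)] decidable_rat_less[OF lhs rhs]]]])
qed

text \<open>\<open>\<phi>\<close> is a total stand-in for the partial function; only its values on
  \<open>I_Q\<close> are constrained.\<close>

locale computable_on_rationals =
  fixes \<phi> :: "real \<Rightarrow> real" and g :: "nat \<Rightarrow> nat \<Rightarrow> nat"
  assumes comp: "computable2 g"
    and approx: "\<And>i k. nth_rat i \<in> I_Q \<Longrightarrow> \<bar>\<phi> (nth_rat i) - nth_rat (g i k)\<bar> \<le> 1 / 2 ^ k"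
begin

text \<open>As \<open>\<bar>\<sigma>\<bar> = 1\<close>, the approximate increment is off by at most
  \<open>2 / 2 ^ k\<close>. Hence certificates are sound, and every strict inequality has one at
  high enough precision: comparing slopes strictly is semidecidable.\<close>

lemma certified_iff:
  assumes "\<bar>\<sigma>\<bar> = 1"
  shows "(\<exists>k. certified g \<sigma> q i j k) \<longleftrightarrow> nth_rat i \<in> I_Q \<and> nth_rat j \<in> I_Q \<and> nth_rat i < nth_rat j \<and>
     \<sigma> * (\<phi> (nth_rat j) - \<phi> (nth_rat i)) < q * (nth_rat j - nth_rat i)"
proof (cases "nth_rat i \<in> I_Q \<and> nth_rat j \<in> I_Q \<and> nth_rat i < nth_rat j")
  case True
  have \<sigma>: "\<sigma> = 1 \<or> \<sigma> = -1" using assms by linarith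
  define A where "A k = \<sigma> * (nth_rat (g j k) - nth_rat (g i k))" for k
  define S where "S = \<sigma> * (\<phi> (nth_rat j) - \<phi> (nth_rat i))"
  define T where "T = q * (nth_rat j - nth_rat i)"
  have err: "\<bar>A k - S\<bar> \<le> 2 * (1 / 2 ^ k)" for k
    using approx[of i k] approx[of j k] True \<sigma> by (auto simp: A_def S_def)
  have cert: "certified g \<sigma> q i j k \<longleftrightarrow> A k < T - 2 * (1 / 2 ^ k)" for k
    using True by (auto simp: certified_def I_Q_def A_def T_def)
  have "S < T" if "certified g \<sigma> q i j k" for k
    using that err[of k] unfolding cert by linarith
  moreover have "\<exists>k. certified g \<sigma> q i j k" if "S < T"
  proof -
    \<comment> \<open>The gap has to hold four units \<open>1 / 2 ^ k\<close>: two for the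
      approximations and two for the margin in \<open>certified\<close>.\<close>
    have "0 < (T - S) / 4" using that by simp
    then obtain k where "1 / 2 ^ k < (T - S) / 4" using half_power_less by blast
    then have "4 * (1 / 2 ^ k) < T - S" by simp
    with abs_le_D1[OF err[of k]] have "certified g \<sigma> q i j k" unfolding cert by linarith
    then show ?thesis ..
  qed
  ultimately show ?thesis using True unfolding S_def T_def by blast
next
  case False
  then show ?thesis by (auto simp: certified_def I_Q_def)
qed

text \<open>The \<open>n\<close>th open set is the union of the certified intervals shorter than
  \<open>1 / 2 ^ n\<close>. Changing the signs of \<open>\<sigma>\<close> and \<open>q\<close>
  covers slopes above a threshold.\<close>

lemma Pi02_class_small_slopes:
  assumes "\<sigma> \<in> \<rat>" "\<bar>\<sigma>\<bar> = 1" "q \<in> \<rat>"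
  shows "Pi02_class {x. \<forall>e>0. \<exists>a b. a \<in> I_Q \<and> b \<in> I_Q \<and> a < x \<and> x < b \<and> b - a < e \<and>
    \<sigma> * (\<phi> b - \<phi> a) < q * (b - a)}" (is "Pi02_class ?P")
proof -
  let ?R = "\<lambda>xs. certified g \<sigma> q (xs ! 1) (xs ! 2) (xs ! 3) \<and>
    nth_rat (xs ! 2) - nth_rat (xs ! 1) < 1 / 2 ^ (xs ! 0)"
  have "decidable 4 ?R"
    by (intro decidable_conj decidable_certified decidable_rat_less computable_rat_diff computable_rat_nth_rat
        computable_rat_half_power rec_fn_proj comp assms) auto
  from Pi02_classI[OF this]
  have "Pi02_class {x. \<forall>n. \<exists>i j k. ?R [n, i, j, k] \<and> nth_rat i < x \<and> x < nth_rat j}" .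
  also have "{x. \<forall>n. \<exists>i j k. ?R [n, i, j, k] \<and> nth_rat i < x \<and> x < nth_rat j} = ?P"
  proof (intro equalityI subsetI CollectI allI impI)
    fix x and e :: real assume x: "x \<in> {x. \<forall>n. \<exists>i j k. ?R [n, i, j, k] \<and> nth_rat i < x \<and> x < nth_rat j}" "0 < e"
    obtain n where n: "1 / 2 ^ n < e" using half_power_less x by blast
    from x(1) obtain i j k where "?R [n, i, j, k]" "nth_rat i < x" "x < nth_rat j" by blast
    then have "certified g \<sigma> q i j k" "nth_rat j - nth_rat i < 1 / 2 ^ n" "nth_rat i < x" "x < nth_rat j"
      by simp_all
    with n certified_iff[OF assms(2), of q i j]
    show "\<exists>a b. a \<in> I_Q \<and> b \<in> I_Q \<and> a < x \<and> x < b \<and> b - a < e \<and> \<sigma> * (\<phi> b - \<phi> a) < q * (b - a)"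
      by (intro exI[of _ "nth_rat i"] exI[of _ "nth_rat j"]) auto
  next
    fix x n assume "x \<in> ?P"
    then obtain a b where ab: "a \<in> I_Q" "b \<in> I_Q" "a < x" "x < b" "b - a < 1 / 2 ^ n" "\<sigma> * (\<phi> b - \<phi> a) < q * (b - a)"
      by (auto dest!: spec[of _ "1 / 2 ^ n"])
    moreover obtain i j where "nth_rat i = a" "nth_rat j = b"
      using nth_rat_surj ab unfolding I_Q_def by blast
    moreover obtain k where "certified g \<sigma> q i j k"
      using certified_iff[OF assms(2), of q i j] calculation by auto
    ultimately show "\<exists>i j k. ?R [n, i, j, k] \<and> nth_rat i < x \<and> x < nth_rat j"
      by (intro exI[of _ i] exI[of _ j] exI[of _ k]) auto
  qed
  finally show ?thesis .
qed

text \<open>Violations are semidecidable. If \<open>n\<close> codes a certified one, the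
  \<open>n\<close>th open set is the complement of its closed interval, and otherwise the whole
  line. The complement is open because \<open>a \<le> x \<le> b\<close> is weak.\<close>

lemma Pi02_class_slopes_bounded_below:
  assumes "\<sigma> \<in> \<rat>" "\<bar>\<sigma>\<bar> = 1" "t \<in> \<rat>" "h \<in> \<rat>"
  shows "Pi02_class {x. \<forall>a b. a \<in> I_Q \<longrightarrow> b \<in> I_Q \<longrightarrow> a \<le> x \<longrightarrow> x \<le> b \<longrightarrow> a < b \<longrightarrow> b - a < h \<longrightarrow>
    t * (b - a) \<le> \<sigma> * (\<phi> b - \<phi> a)}" (is "Pi02_class ?P")
proof -
  define I where "I m = fst (prod_decode m)" for m
  define J where "J m = fst (prod_decode (snd (prod_decode m)))" for m
  define K where "K m = snd (prod_decode (snd (prod_decode m)))" for m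
  define bad where "bad n \<longleftrightarrow> certified g \<sigma> t (I n) (J n) (K n) \<and> nth_rat (J n) - nth_rat (I n) < h" for n
  \<comment> \<open>\<open>xs ! 1\<close> and \<open>xs ! 2\<close> index the ends of the interval
    around \<open>x\<close>, which must lie to one side of the violating interval coded by
    \<open>xs ! 0\<close>.\<close>
  let ?R = "\<lambda>xs. bad (xs ! 0) \<longrightarrow> nth_rat (xs ! 2) \<le> nth_rat (I (xs ! 0)) \<or> nth_rat (J (xs ! 0)) \<le> nth_rat (xs ! 1)"
  have IJK: "rec_fn 4 (\<lambda>xs. I (xs ! 0))" "rec_fn 4 (\<lambda>xs. J (xs ! 0))" "rec_fn 4 (\<lambda>xs. K (xs ! 0))"
    unfolding I_def J_def K_def by (intro rec_fn_prod_decode rec_fn_proj; simp)+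
  have "decidable 4 ?R"
    unfolding bad_def
    by (intro decidable_imp decidable_disj decidable_conj decidable_certified decidable_rat_less decidable_rat_le
        computable_rat_diff computable_rat_nth_rat computable_rat_const IJK rec_fn_proj comp assms) auto
  from Pi02_classI[OF this]
  have "Pi02_class {x. \<forall>n. \<exists>i j k. ?R [n, i, j, k] \<and> nth_rat i < x \<and> x < nth_rat j}" .
  also have "{x. \<forall>n. \<exists>i j k. ?R [n, i, j, k] \<and> nth_rat i < x \<and> x < nth_rat j} = ?P"
  proof (intro equalityI subsetI CollectI allI impI)
    fix x a b
    assume x: "x \<in> {x. \<forall>n. \<exists>i j k. ?R [n, i, j, k] \<and> nth_rat i < x \<and> x < nth_rat j}"
      and ab: "a \<in> I_Q" "b \<in> I_Q" "a \<le> x" "x \<le> b" "a < b" "b - a < h"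
    show "t * (b - a) \<le> \<sigma> * (\<phi> b - \<phi> a)"
    proof (rule ccontr)
      assume "\<not> ?thesis"
      moreover obtain i j where ij: "nth_rat i = a" "nth_rat j = b"
        using nth_rat_surj ab unfolding I_Q_def by blast
      ultimately obtain k where "certified g \<sigma> t i j k"
        using certified_iff[OF assms(2), of t i j] ab by auto
      then have "bad n" "I n = i" "J n = j" if "n = prod_encode (i, prod_encode (j, k))" for n
        using ab ij by (simp_all add: bad_def I_def J_def K_def that)
      note bad = this
      define n where "n = prod_encode (i, prod_encode (j, k))"
      from x obtain i' j' k' where "?R [n, i', j', k']" "nth_rat i' < x" "x < nth_rat j'" by blast
      with bad[OF n_def] ij ab show False by simp
    qed
  next
    fix x n assume x: "x \<in> ?P"
    show "\<exists>i j k. ?R [n, i, j, k] \<and> nth_rat i < x \<and> x < nth_rat j"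
    proof (cases "bad n")
      case True
      with certified_iff[OF assms(2), of t "I n" "J n"]
      have "nth_rat (I n) \<in> I_Q" "nth_rat (J n) \<in> I_Q" "nth_rat (I n) < nth_rat (J n)" "nth_rat (J n) - nth_rat (I n) < h"
        "\<not> t * (nth_rat (J n) - nth_rat (I n)) \<le> \<sigma> * (\<phi> (nth_rat (J n)) - \<phi> (nth_rat (I n)))"
        by (auto simp: bad_def not_le)
      with x have "x < nth_rat (I n) \<or> nth_rat (J n) < x" by force
      from rat_interval_avoiding[OF this] show ?thesis by simp blast
    next
      case False
      have "\<exists>i j. nth_rat i < x \<and> x < nth_rat j"
        using rat_interval_avoiding[of x "x + 1" x] by auto
      with False show ?thesis by simp
    qed
  qed
  finally show ?thesis .
qed

text \<open>The points sharing these three slope conditions with \<open>z\<close> form a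
  \<open>\<Pi>\<^sup>0\<^sub>2\<close> class, which is null by \<open>negligible_slope_gap\<close>;
  weak 2-randomness keeps \<open>z\<close> out of it.\<close>

lemma weakly_2_random_no_slope_gap:
  assumes z: "weakly_2_random z" and \<sigma>: "\<sigma> = 1 \<or> \<sigma> = -1"
    and rat: "t \<in> \<rat>" "q \<in> \<rat>" "r \<in> \<rat>" and "0 < h" and gap: "2 * (q - t) < r - t"
    and low: "\<And>a b. a \<in> I_Q \<Longrightarrow> b \<in> I_Q \<Longrightarrow> a \<le> z \<Longrightarrow> z \<le> b \<Longrightarrow> a < b \<Longrightarrow> b - a < h \<Longrightarrow>
      t * (b - a) \<le> \<sigma> * (\<phi> b - \<phi> a)"
    and mid: "\<And>e. 0 < e \<Longrightarrow> \<exists>a b. a \<in> I_Q \<and> b \<in> I_Q \<and> a \<le> z \<and> z \<le> b \<and> b - a < e \<and>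
      \<sigma> * (\<phi> b - \<phi> a) < q * (b - a)"
    and hi: "\<And>e. 0 < e \<Longrightarrow> \<exists>a b. a \<in> I_Q \<and> b \<in> I_Q \<and> a \<le> z \<and> z \<le> b \<and> b - a < e \<and>
      r * (b - a) < \<sigma> * (\<phi> b - \<phi> a)"
  shows False
proof -
  have zQ: "z \<notin> \<rat>" using z by (rule weakly_2_random_irrational)
  have strict: "a < z" if "a \<in> I_Q" "a \<le> z" for a using that zQ by (auto simp: I_Q_def le_less)
  have strict': "z < a" if "a \<in> I_Q" "z \<le> a" for a using that zQ by (auto simp: I_Q_def le_less)
  \<comment> \<open>The class is effective only for a rational scale, so \<open>h\<close> is
    decreased to one.\<close>
  obtain h' where h': "h' \<in> \<rat>" "0 < h'" "h' < h" using Rats_dense_in_real[OF \<open>0 < h\<close>] by auto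
  have \<sigma>': "\<sigma> \<in> \<rat>" "- \<sigma> \<in> \<rat>" "\<bar>\<sigma>\<bar> = 1" "\<bar>- \<sigma>\<bar> = 1" using \<sigma> by auto
  define L where "L = {x. \<forall>a b. a \<in> I_Q \<longrightarrow> b \<in> I_Q \<longrightarrow> a \<le> x \<longrightarrow> x \<le> b \<longrightarrow> a < b \<longrightarrow> b - a < h' \<longrightarrow>
    t * (b - a) \<le> \<sigma> * (\<phi> b - \<phi> a)}"
  define M where "M \<sigma> q = {x. \<forall>e>0. \<exists>a b. a \<in> I_Q \<and> b \<in> I_Q \<and> a < x \<and> x < b \<and> b - a < e \<and>
    \<sigma> * (\<phi> b - \<phi> a) < q * (b - a)}" for \<sigma> q
  \<comment> \<open>Slopes of \<open>\<sigma> \<phi>\<close> above \<open>r\<close> are expressed as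
    slopes of its negative below \<open>- r\<close>.\<close>
  define P where "P = L \<inter> M \<sigma> q \<inter> M (- \<sigma>) (- r)"
  have Pi: "Pi02_class P"
    unfolding P_def L_def M_def using \<sigma>' rat h'
    by (intro Pi02_class_Int Pi02_class_slopes_bounded_below Pi02_class_small_slopes) auto
  have "z \<in> L" using low h' by (auto simp: L_def)
  moreover have "z \<in> M \<sigma> q"
    unfolding M_def mem_Collect_eq using mid strict strict' by meson
  moreover have "z \<in> M (- \<sigma>) (- r)"
    unfolding M_def mem_Collect_eq
  proof (intro allI impI)
    fix e :: real assume "0 < e"
    from hi[OF this] obtain a b where "a \<in> I_Q" "b \<in> I_Q" "a \<le> z" "z \<le> b" "b - a < e"
      "r * (b - a) < \<sigma> * (\<phi> b - \<phi> a)" by blast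
    then show "\<exists>a b. a \<in> I_Q \<and> b \<in> I_Q \<and> a < z \<and> z < b \<and> b - a < e \<and>
        - \<sigma> * (\<phi> b - \<phi> a) < - r * (b - a)"
      using strict[of a] strict'[of b] by (intro exI[of _ a] exI[of _ b]) simp
  qed
  ultimately have "z \<in> P" by (simp add: P_def)
  have "P \<subseteq> {0..1}"
  proof
    fix x assume "x \<in> P"
    then have "x \<in> M \<sigma> q" by (simp add: P_def)
    then obtain a b where "a \<in> I_Q" "b \<in> I_Q" "a < x" "x < b"
      unfolding M_def by (auto dest: spec[of _ 1])
    then show "x \<in> {0..1}" by (auto simp: I_Q_def)
  qed
  then have "bounded P" using bounded_closed_interval bounded_subset by blast
  have borel: "P \<in> sets borel" by (rule Pi02_class_borel[OF Pi])
  have "negligible P"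
  proof (rule negligible_slope_gap[where D = I_Q and \<phi> = "\<lambda>x. \<sigma> * \<phi> x" and t = t and q = q and r = r and h = h'])
    show "P \<in> lmeasurable" using borel \<open>bounded P\<close>
      by (intro bounded_set_imp_lmeasurable) auto
    show "t * (b - a) \<le> \<sigma> * \<phi> b - \<sigma> * \<phi> a"
      if "x \<in> P" "a \<in> I_Q" "b \<in> I_Q" "a < x" "x < b" "b - a < h'" for x a b
      using that by (auto simp: P_def L_def right_diff_distrib)
    show "\<exists>a b. a \<in> I_Q \<and> b \<in> I_Q \<and> a < x \<and> x < b \<and> b - a < e \<and> \<sigma> * \<phi> b - \<sigma> * \<phi> a < q * (b - a)"
      if "x \<in> P" "0 < e" for x e
      using that by (simp add: P_def M_def right_diff_distrib)
    show "\<exists>a b. a \<in> I_Q \<and> b \<in> I_Q \<and> a < x \<and> x < b \<and> b - a < e \<and> r * (b - a) < \<sigma> * \<phi> b - \<sigma> * \<phi> a"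
      if "x \<in> P" "0 < e" for x e
    proof -
      have "x \<in> M (- \<sigma>) (- r)" using that by (simp add: P_def)
      with that(2) obtain a b where "a \<in> I_Q" "b \<in> I_Q" "a < x" "x < b" "b - a < e"
        "- \<sigma> * (\<phi> b - \<phi> a) < - r * (b - a)"
        unfolding M_def by blast
      then show ?thesis by (intro exI[of _ a] exI[of _ b]) (simp add: right_diff_distrib)
    qed
  qed (use h' gap in auto)
  \<comment> \<open>\<open>negligible\<close> refers to the completed measure; for a Borel set this
    agrees with being null for \<open>lborel\<close>.\<close>
  then have "P \<in> null_sets lborel"
    using borel by (simp add: negligible_iff_null_sets null_sets_completion_iff)
  with z Pi \<open>z \<in> P\<close> show False by (auto simp: weakly_2_random_def)
qed

end

subsection \<open>Pseudo-derivatives\<close>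

lemma slopes_near_mono: "h \<le> h' \<Longrightarrow> slopes_near f x h \<subseteq> slopes_near f x h'"
  unfolding slopes_near_def by fastforce

lemma less_lower_pseudo_derivD:
  assumes "t < lower_pseudo_deriv f x"
  shows "\<exists>h>0. \<forall>s\<in>slopes_near f x h. t < ereal s"
proof -
  have "\<forall>\<^sub>F h in at_right 0. t < (INF s\<in>slopes_near f x h. ereal s)"
    using assms unfolding lower_pseudo_deriv_def by (rule less_LiminfD)
  then obtain b where b: "0 < b" "\<And>h. 0 < h \<Longrightarrow> h < b \<Longrightarrow> t < (INF s\<in>slopes_near f x h. ereal s)"
    unfolding eventually_at_right_field by auto
  then have "t < (INF s\<in>slopes_near f x (b / 2). ereal s)" by simp
  then have "\<forall>s\<in>slopes_near f x (b / 2). t < ereal s" by (auto dest: less_INF_D)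
  with b(1) show ?thesis by (intro exI[of _ "b / 2"]) auto
qed

text \<open>If all slopes at scale \<open>e\<close> were at least \<open>q\<close>, so would be
  those at smaller scales, which are among them, and hence the limit inferior.\<close>

lemma lower_pseudo_deriv_lessD:
  assumes "lower_pseudo_deriv f x < q" "0 < e"
  shows "\<exists>s\<in>slopes_near f x e. ereal s < q"
proof (rule ccontr)
  assume *: "\<not> ?thesis"
  have "\<forall>\<^sub>F h in at_right 0. q \<le> (INF s\<in>slopes_near f x h. ereal s)"
    unfolding eventually_at_right_field
  proof (intro exI[of _ e] conjI allI impI)
    fix h assume "0 < h" "h < e"
    then have "slopes_near f x h \<subseteq> slopes_near f x e" by (intro slopes_near_mono) simp
    with * show "q \<le> (INF s\<in>slopes_near f x h. ereal s)" by (intro INF_greatest) (auto simp: not_less)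
  qed fact
  then have "q \<le> lower_pseudo_deriv f x"
    unfolding lower_pseudo_deriv_def by (rule Liminf_bounded)
  with assms(1) show False by simp
qed

lemma upper_pseudo_deriv_lessD:
  assumes "upper_pseudo_deriv f x < t"
  shows "\<exists>h>0. \<forall>s\<in>slopes_near f x h. ereal s < t"
proof -
  have "\<forall>\<^sub>F h in at_right 0. (SUP s\<in>slopes_near f x h. ereal s) < t"
    using assms unfolding upper_pseudo_deriv_def by (rule Limsup_lessD)
  then obtain b where b: "0 < b" "\<And>h. 0 < h \<Longrightarrow> h < b \<Longrightarrow> (SUP s\<in>slopes_near f x h. ereal s) < t"
    unfolding eventually_at_right_field by auto
  then have "(SUP s\<in>slopes_near f x (b / 2). ereal s) < t" by simp
  then have "\<forall>s\<in>slopes_near f x (b / 2). ereal s < t" by (auto dest: SUP_lessD)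
  with b(1) show ?thesis by (intro exI[of _ "b / 2"]) auto
qed

lemma less_upper_pseudo_derivD:
  assumes "q < upper_pseudo_deriv f x" "0 < e"
  shows "\<exists>s\<in>slopes_near f x e. q < ereal s"
proof (rule ccontr)
  assume *: "\<not> ?thesis"
  have "\<forall>\<^sub>F h in at_right 0. (SUP s\<in>slopes_near f x h. ereal s) \<le> q"
    unfolding eventually_at_right_field
  proof (intro exI[of _ e] conjI allI impI)
    fix h assume "0 < h" "h < e"
    then have "slopes_near f x h \<subseteq> slopes_near f x e" by (intro slopes_near_mono) simp
    with * show "(SUP s\<in>slopes_near f x h. ereal s) \<le> q" by (intro SUP_least) (auto simp: not_less)
  qed fact
  then have "upper_pseudo_deriv f x \<le> q"
    unfolding upper_pseudo_deriv_def by (rule Limsup_bounded)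
  with assms(1) show False by simp
qed

text \<open>Over an empty set of slopes the infimum is \<open>\<infinity>\<close> and the supremum
  \<open>-\<infinity>\<close>, so slopes must exist at every scale.\<close>

lemma lower_le_upper_pseudo_deriv:
  assumes "\<And>h. 0 < h \<Longrightarrow> slopes_near f x h \<noteq> {}"
  shows "lower_pseudo_deriv f x \<le> upper_pseudo_deriv f x"
proof -
  have "\<forall>\<^sub>F h in at_right 0. (INF s\<in>slopes_near f x h. ereal s) \<le> (SUP s\<in>slopes_near f x h. ereal s)"
    unfolding eventually_at_right_field using assms by (intro exI[of _ 1]) (auto intro!: INF_le_SUP)
  then have "lower_pseudo_deriv f x \<le> Liminf (at_right 0) (\<lambda>h. SUP s\<in>slopes_near f x h. ereal s)"
    unfolding lower_pseudo_deriv_def by (rule Liminf_mono)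
  also have "\<dots> \<le> upper_pseudo_deriv f x"
    unfolding upper_pseudo_deriv_def by (rule Liminf_le_Limsup) simp
  finally show ?thesis .
qed

section \<open>The Denjoy alternative at weakly 2-random points\<close>

theorem theorem5p4:
  fixes f :: "real \<rightharpoonup> real" and z :: real
  assumes "dom f \<subseteq> {0..1}"
    and "computable_on_I_Q f"
    and "z \<in> {0..1}"
    and "weakly_2_random z"
  shows "Denjoy_alternative f z"
proof (rule ccontr)
  define \<phi> where "\<phi> x = the (f x)" for x
  obtain g where g: "computable2 g"
    "\<And>i k. nth_rat i \<in> I_Q \<Longrightarrow> \<bar>\<phi> (nth_rat i) - nth_rat (g i k)\<bar> \<le> 1 / 2 ^ k"
    using assms(2) unfolding computable_on_I_Q_def \<phi>_def by blast
  interpret computable_on_rationals \<phi> g by unfold_locales (rule g; assumption?)+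
  have dom: "dom f \<inter> \<rat> = I_Q"
    using assms(1,2) by (auto simp: computable_on_I_Q_def I_Q_def)
  have slopes: "slopes_near f z h = {(\<phi> b - \<phi> a) / (b - a) | a b. a \<in> I_Q \<and> b \<in> I_Q \<and>
      a \<le> z \<and> z \<le> b \<and> 0 < b - a \<and> b - a \<le> h}" for h
  proof -
    have "slope f a b = (\<phi> b - \<phi> a) / (b - a)" for a b
      unfolding slope_def \<phi>_def by (metis minus_diff_eq minus_divide_divide)
    then show ?thesis by (simp add: slopes_near_def dom)
  qed
  \<comment> \<open>The choice \<open>\<sigma> = -1\<close> treats \<open>-f\<close>.\<close>
  have no_gap: False
    if "\<sigma> = 1 \<or> \<sigma> = -1" "t \<in> \<rat>" "q \<in> \<rat>" "r \<in> \<rat>" "2 * (q - t) < r - t" "0 < h"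
      "\<And>s. s \<in> slopes_near f z h \<Longrightarrow> t < \<sigma> * s"
      "\<And>e. 0 < e \<Longrightarrow> \<exists>s\<in>slopes_near f z e. \<sigma> * s < q"
      "\<And>e. 0 < e \<Longrightarrow> \<exists>s\<in>slopes_near f z e. r < \<sigma> * s"
    for \<sigma> t q r h
  proof (rule weakly_2_random_no_slope_gap[OF assms(4) that(1-4,6,5)])
    fix a b assume ab: "a \<in> I_Q" "b \<in> I_Q" "a \<le> z" "z \<le> b" "a < b" "b - a < h"
    then have "(\<phi> b - \<phi> a) / (b - a) \<in> slopes_near f z h" unfolding slopes by force
    from that(7)[OF this] ab show "t * (b - a) \<le> \<sigma> * (\<phi> b - \<phi> a)"
      by (simp add: pos_less_divide_eq less_imp_le)
  next
    fix e :: real assume "0 < e"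
    \<comment> \<open>\<open>slopes_near f z e\<close> admits intervals of length exactly
      \<open>e\<close>, while a smaller length is required; halving the scale ensures it.\<close>
    then have "0 < e / 2" by simp
    from that(8)[OF this] obtain a b where "a \<in> I_Q" "b \<in> I_Q" "a \<le> z" "z \<le> b" "0 < b - a" "b - a \<le> e / 2"
      "\<sigma> * ((\<phi> b - \<phi> a) / (b - a)) < q" unfolding slopes by blast
    with \<open>0 < e\<close> show "\<exists>a b. a \<in> I_Q \<and> b \<in> I_Q \<and> a \<le> z \<and> z \<le> b \<and> b - a < e \<and>
        \<sigma> * (\<phi> b - \<phi> a) < q * (b - a)"
      by (intro exI[of _ a] exI[of _ b]) (auto simp: pos_divide_less_eq)
  next
    fix e :: real assume "0 < e"
    then have "0 < e / 2" by simp
    from that(9)[OF this] obtain a b where "a \<in> I_Q" "b \<in> I_Q" "a \<le> z" "z \<le> b" "0 < b - a" "b - a \<le> e / 2"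
      "r < \<sigma> * ((\<phi> b - \<phi> a) / (b - a))" unfolding slopes by blast
    with \<open>0 < e\<close> show "\<exists>a b. a \<in> I_Q \<and> b \<in> I_Q \<and> a \<le> z \<and> z \<le> b \<and> b - a < e \<and>
        r * (b - a) < \<sigma> * (\<phi> b - \<phi> a)"
      by (intro exI[of _ a] exI[of _ b]) (auto simp: pos_less_divide_eq)
  qed
  \<comment> \<open>An interior point has rationals of the unit interval on both sides, so slopes
    exist at every scale.\<close>
  have "z \<noteq> 0" "z \<noteq> 1" using weakly_2_random_irrational[OF assms(4)] by auto
  with assms(3) have z: "0 < z" "z < 1" by auto
  have "slopes_near f z h \<noteq> {}" if "0 < h" for h
  proof -
    obtain a where a: "a \<in> \<rat>" "max 0 (z - h / 2) < a" "a < z"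
      using Rats_dense_in_real[of "max 0 (z - h / 2)" z] z \<open>0 < h\<close> by auto
    obtain b where b: "b \<in> \<rat>" "z < b" "b < min 1 (z + h / 2)"
      using Rats_dense_in_real[of z "min 1 (z + h / 2)"] z \<open>0 < h\<close> by auto
    have "(\<phi> b - \<phi> a) / (b - a) \<in> slopes_near f z h"
      unfolding slopes using a b z by (fastforce simp: I_Q_def)
    then show ?thesis by auto
  qed
  then have le: "lower_pseudo_deriv f z \<le> upper_pseudo_deriv f z"
    by (rule lower_le_upper_pseudo_deriv)
  assume "\<not> Denjoy_alternative f z"
  with le have less: "lower_pseudo_deriv f z < upper_pseudo_deriv f z"
    and fin: "lower_pseudo_deriv f z \<noteq> -\<infinity> \<or> upper_pseudo_deriv f z \<noteq> \<infinity>"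
    unfolding Denjoy_alternative_def by auto
  from fin show False
  proof
    assume "lower_pseudo_deriv f z \<noteq> -\<infinity>"
    with less obtain l where l: "lower_pseudo_deriv f z = ereal l"
      by (cases "lower_pseudo_deriv f z") auto
    from ereal_dense2[OF less] obtain u where u: "ereal l < ereal u" "ereal u < upper_pseudo_deriv f z"
      unfolding l by auto
    obtain r where r: "r \<in> \<rat>" "l < r" "r < u" using Rats_dense_in_real[of l u] u by auto
    \<comment> \<open>With \<open>t\<close> and \<open>q\<close> within \<open>d\<close> of
      \<open>l\<close>, the gap is \<open>2 (q - t) < 4 d = r - l < r - t\<close>.\<close>
    define d where "d = (r - l) / 4"
    have "0 < d" using r by (simp add: d_def)
    obtain t where t: "t \<in> \<rat>" "l - d < t" "t < l" using Rats_dense_in_real[of "l - d" l] \<open>0 < d\<close> by auto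
    obtain q where q: "q \<in> \<rat>" "l < q" "q < l + d" using Rats_dense_in_real[of l "l + d"] \<open>0 < d\<close> by auto
    obtain h where h: "0 < h" "\<And>s. s \<in> slopes_near f z h \<Longrightarrow> t < s"
      using less_lower_pseudo_derivD[of "ereal t" f z] t(3) by (auto simp: l)
    have "\<exists>s\<in>slopes_near f z e. s < q" if "0 < e" for e
      using lower_pseudo_deriv_lessD[of f z "ereal q", OF _ that] q(2) by (auto simp: l)
    moreover have "\<exists>s\<in>slopes_near f z e. r < s" if "0 < e" for e
    proof -
      have "ereal r < upper_pseudo_deriv f z" by (rule less_trans[OF _ u(2)]) (simp add: r)
      from less_upper_pseudo_derivD[OF this that] show ?thesis by simp
    qed
    moreover have "2 * (q - t) < r - t" using t q by (simp add: d_def field_simps)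
    ultimately show False
      using no_gap[of 1 t q r h] t(1) q(1) r(1) h by simp
  next
    assume "upper_pseudo_deriv f z \<noteq> \<infinity>"
    with less obtain u where u: "upper_pseudo_deriv f z = ereal u"
      by (cases "upper_pseudo_deriv f z") auto
    from ereal_dense2[OF less] obtain l where l: "lower_pseudo_deriv f z < ereal l" "ereal l < ereal u"
      unfolding u by auto
    obtain r where r: "r \<in> \<rat>" "l < r" "r < u" using Rats_dense_in_real[of l u] l by auto
    \<comment> \<open>The mirrored choice around the finite upper value:
      \<open>2 (t - q) < 4 d = u - r < t - r\<close>.\<close>
    define d where "d = (u - r) / 4"
    have "0 < d" using r by (simp add: d_def)
    obtain t where t: "t \<in> \<rat>" "u < t" "t < u + d" using Rats_dense_in_real[of u "u + d"] \<open>0 < d\<close> by auto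
    obtain q where q: "q \<in> \<rat>" "u - d < q" "q < u" using Rats_dense_in_real[of "u - d" u] \<open>0 < d\<close> by auto
    obtain h where h: "0 < h" "\<And>s. s \<in> slopes_near f z h \<Longrightarrow> s < t"
      using upper_pseudo_deriv_lessD[of f z "ereal t"] t(2) by (auto simp: u)
    have "\<exists>s\<in>slopes_near f z e. q < s" if "0 < e" for e
      using less_upper_pseudo_derivD[of "ereal q" f z, OF _ that] q(3) by (auto simp: u)
    moreover have "\<exists>s\<in>slopes_near f z e. s < r" if "0 < e" for e
    proof -
      have "lower_pseudo_deriv f z < ereal r" by (rule less_trans[OF l(1)]) (simp add: r)
      from lower_pseudo_deriv_lessD[OF this that] show ?thesis by simp
    qed
    moreover have "2 * (- q - - t) < - r - - t" using t q by (simp add: d_def field_simps)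
    ultimately show False
      using no_gap[of "- 1" "- t" "- q" "- r" h] t(1) q(1) r(1) h by simp
  qed
qed

end
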